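(* The following are equivalent: (i) $\|E(S_n\mid X_0)\| = o(\sigma_n)$ as $n\to\infty$. (ii) There is an approximate solution to Poisson's equation for $g$, i.e. a sequence $h_n \in L^2(\pi)$ with $\|h_n\| + n\|(I-Q)h_n - g\| = o(\sigma_n)$ as $n\to\infty$. (iii) There is a stationary martingale approximation to $S_n$. (iv) There is a nontriangular martingale approximation to $S_n$. In this case (i.e. when these equivalent conditions hold), $E(D_{n1}^2) \sim \ell(n)$ for any stationary martingale approximation $(D_{nj})$, where $\ell(n) = \sigma_n^2/n$ (a slowly varying function of $n$); and there is a stationary martingale approximation for which $\max_{k\le n}\|S_k - M_{nk}\| \le 3\max_{k\le n}\|E(S_k\mid X_0)\|$.
   Context: Let $(X_n)_{n\in\mathbb{Z}}$ be a stationary and ergodic Markov chain, on a probability space with probability $P$, with values in a state space $\mathcal{X}$. Let $\pi$ denote the marginal distribution of $X_0$; suppose there is a regular conditional distribution for $X_1$ given $X_0$, $Q(x;B)=P(X_1\in B\mid X_0=x)$, and write $Qh(x)=E[h(X_1)\mid X_0=x]$ for a.e. $x$ $(\pi)$, $h\in L^1(\pi)$. Let $g:\mathcal{X}\to\mathbb{R}$ be measurable with $E[g(X_0)]=0$ and $E[g(X_0)^2]<\infty$. Put $S_n=\sum_{i=1}^n g(X_i)$ and $\sigma_n^2=E(S_n^2)$, and assume $\sigma_n^2\to\infty$ as $n\to\infty$. $\|\cdot\|$ denotes the norm of $L^2(P)$ for random variables and of $L^2(\pi)$ for functions on $\mathcal{X}$. For (eventually) positive sequences, $a_n\sim b_n$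 means $a_n/b_n\to1$. Let $\mathcal{F}_j=\sigma(\ldots,X_{j-1},X_j)$. A doubly indexed sequence $D_{nj}$ ($n,j\ge1$) of random variables such that for each $n$, $D_{nj}$, $j=1,2,\ldots$, are martingale differences with respect to $(\mathcal{F}_j)$, with associated martingales $M_{nk}=D_{n1}+\cdots+D_{nk}$, is called a martingale approximation (to $S_n$) if $\max_{k\le n}E[(S_k-M_{nk})^2]=o(\sigma_n^2)$ as $n\to\infty$. It is called stationary if $D_{nj}$, $j=1,2,\ldots$, is a stationary sequence for each $n$, and nontriangular if $D_{nj}=D_j$ does not depend on $n$. *)

theory Defs
  imports "HOL-Probability.Probability" "HOL-Library.Landau_Symbols"
begin

text \<open>Throughout, \<open>M\<close> is the underlying probability space, the measure \<open>N\<close> only carries the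
  measurable structure of the state space, and \<open>X i\<close> is the state of the chain at time \<open>i\<close>.\<close>

definition gen_alg :: "'w measure \<Rightarrow> 's measure \<Rightarrow> ('w \<Rightarrow> 's) \<Rightarrow> 'w measure" where
  "gen_alg M N Y = vimage_algebra (space M) Y N"

definition past_alg :: "'w measure \<Rightarrow> 's measure \<Rightarrow> (int \<Rightarrow> 'w \<Rightarrow> 's) \<Rightarrow> int \<Rightarrow> 'w measure" where
  "past_alg M N X j = sigma (space M) (\<Union>i\<in>{..j}. {X i -` A \<inter> space M | A. A \<in> sets N})"

text \<open>Used with \<open>I = UNIV :: int set\<close> for the chain and with \<open>I = {1..} :: nat set\<close> for the
  martingale differences; in both cases the side condition on \<open>k\<close> always holds.\<close>

definition stationary_process ::
    "'w measure \<Rightarrow> 's measure \<Rightarrow> 'i::ab_semigroup_add set \<Rightarrow> ('i \<Rightarrow> 'w \<Rightarrow> 's) \<Rightarrow> bool" where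
  "stationary_process M N I X \<longleftrightarrow>
     (\<forall>i\<in>I. X i \<in> measurable M N) \<and>
     (\<forall>k. (\<forall>i\<in>I. i + k \<in> I) \<longrightarrow>
        distr M (\<Pi>\<^sub>M i\<in>I. N) (\<lambda>\<omega>. \<lambda>i\<in>I. X (i + k) \<omega>) =
        distr M (\<Pi>\<^sub>M i\<in>I. N) (\<lambda>\<omega>. \<lambda>i\<in>I. X i \<omega>))"

definition ergodic_process :: "'w measure \<Rightarrow> 's measure \<Rightarrow> (int \<Rightarrow> 'w \<Rightarrow> 's) \<Rightarrow> bool" where
  "ergodic_process M N X \<longleftrightarrow>
     (\<forall>A \<in> sets (\<Pi>\<^sub>M i\<in>UNIV. N).
        (\<lambda>x i. x (i + 1)) -` A \<inter> space (\<Pi>\<^sub>M i\<in>UNIV. N) = A \<longrightarrow>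
        measure M {\<omega> \<in> space M. (\<lambda>i. X i \<omega>) \<in> A} \<in> {0, 1})"

definition markov_chain :: "'w measure \<Rightarrow> 's measure \<Rightarrow> (int \<Rightarrow> 'w \<Rightarrow> 's) \<Rightarrow> bool" where
  "markov_chain M N X \<longleftrightarrow>
     (\<forall>i. X i \<in> measurable M N) \<and>
     (\<forall>i. \<forall>B\<in>sets N. AE \<omega> in M.
        real_cond_exp M (past_alg M N X i) (\<lambda>\<omega>. indicator B (X (i + 1) \<omega>)) \<omega> =
        real_cond_exp M (gen_alg M N (X i)) (\<lambda>\<omega>. indicator B (X (i + 1) \<omega>)) \<omega>)"

definition regular_cond_distr ::
    "'w measure \<Rightarrow> 's measure \<Rightarrow> ('w \<Rightarrow> 's) \<Rightarrow> ('w \<Rightarrow> 's) \<Rightarrow> ('s \<Rightarrow> 's measure) \<Rightarrow> bool" where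
  \<comment> \<open>\<open>Q\<close> is a regular conditional distribution for \<open>Z\<close> given \<open>Y\<close>\<close>
  "regular_cond_distr M N Z Y Q \<longleftrightarrow>
     Q \<in> measurable N (prob_algebra N) \<and>
     (\<forall>B\<in>sets N. AE \<omega> in M.
        real_cond_exp M (gen_alg M N Y) (\<lambda>\<omega>. indicator B (Z \<omega>)) \<omega> = measure (Q (Y \<omega>)) B)"

definition kernel_op :: "('s \<Rightarrow> 's measure) \<Rightarrow> ('s \<Rightarrow> real) \<Rightarrow> 's \<Rightarrow> real" where
  "kernel_op Q h x = (\<integral>y. h y \<partial>Q x)"

definition in_L2 :: "'w measure \<Rightarrow> ('w \<Rightarrow> real) \<Rightarrow> bool" where
  "in_L2 M f \<longleftrightarrow> f \<in> borel_measurable M \<and> integrable M (\<lambda>\<omega>. (f \<omega>)\<^sup>2)"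

text \<open>Meaningful only under \<^const>\<open>in_L2\<close>: the Bochner integral of a non-integrable
  function is 0.\<close>

definition norm_L2 :: "'w measure \<Rightarrow> ('w \<Rightarrow> real) \<Rightarrow> real" where
  "norm_L2 M f = sqrt (\<integral>\<omega>. (f \<omega>)\<^sup>2 \<partial>M)"

definition psum :: "(int \<Rightarrow> 'w \<Rightarrow> 's) \<Rightarrow> ('s \<Rightarrow> real) \<Rightarrow> nat \<Rightarrow> 'w \<Rightarrow> real" where
  "psum X g n \<omega> = (\<Sum>i=1..n. g (X (int i) \<omega>))"

definition sigma_sq :: "'w measure \<Rightarrow> (int \<Rightarrow> 'w \<Rightarrow> 's) \<Rightarrow> ('s \<Rightarrow> real) \<Rightarrow> nat \<Rightarrow> real" where
  "sigma_sq M X g n = (\<integral>\<omega>. (psum X g n \<omega>)\<^sup>2 \<partial>M)"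

definition cond_psum ::
    "'w measure \<Rightarrow> 's measure \<Rightarrow> (int \<Rightarrow> 'w \<Rightarrow> 's) \<Rightarrow> ('s \<Rightarrow> real) \<Rightarrow> nat \<Rightarrow> 'w \<Rightarrow> real" where
  "cond_psum M N X g n = real_cond_exp M (gen_alg M N (X 0)) (psum X g n)"

text \<open>The filtration is indexed by \<open>int\<close>, so for \<open>j = 1\<close> the condition reads
  \<open>E(D 1 | F 0) = 0\<close>.\<close>

definition martingale_differences ::
    "'w measure \<Rightarrow> (int \<Rightarrow> 'w measure) \<Rightarrow> (nat \<Rightarrow> 'w \<Rightarrow> real) \<Rightarrow> bool" where
  "martingale_differences M F D \<longleftrightarrow>
     (\<forall>j\<ge>1. D j \<in> borel_measurable (F (int j)) \<and> integrable M (D j) \<and>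
        (AE \<omega> in M. real_cond_exp M (F (int j - 1)) (D j) \<omega> = 0))"

text \<open>The second conjunct expresses that the expectations in the third are finite for large \<open>n\<close>,
  which is part of the meaning of the little-o condition for \<open>[0,\<infinity>]\<close>-valued expectations.\<close>

definition martingale_approximation ::
    "'w measure \<Rightarrow> 's measure \<Rightarrow> (int \<Rightarrow> 'w \<Rightarrow> 's) \<Rightarrow> ('s \<Rightarrow> real) \<Rightarrow>
      (nat \<Rightarrow> nat \<Rightarrow> 'w \<Rightarrow> real) \<Rightarrow> bool" where
  "martingale_approximation M N X g D \<longleftrightarrow>
     (\<forall>n\<ge>1. martingale_differences M (past_alg M N X) (D n)) \<and>
     (\<forall>\<^sub>F n in sequentially. \<forall>k\<in>{1..n}. in_L2 M (\<lambda>\<omega>. psum X g k \<omega> - (\<Sum>j=1..k. D n j \<omega>))) \<and>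
     (\<lambda>n. MAX k\<in>{1..n}. \<integral>\<omega>. (psum X g k \<omega> - (\<Sum>j=1..k. D n j \<omega>))\<^sup>2 \<partial>M)
       \<in> o(\<lambda>n. sigma_sq M X g n)"

definition stationary_array :: "'w measure \<Rightarrow> (nat \<Rightarrow> nat \<Rightarrow> 'w \<Rightarrow> real) \<Rightarrow> bool" where
  "stationary_array M D \<longleftrightarrow> (\<forall>n\<ge>1. stationary_process M borel {1..} (D n))"

definition nontriangular :: "(nat \<Rightarrow> nat \<Rightarrow> 'w \<Rightarrow> real) \<Rightarrow> bool" where
  "nontriangular D \<longleftrightarrow> (\<exists>D'. \<forall>n\<ge>1. \<forall>j\<ge>1. D n j = D' j)"

definition slowly_varying :: "(nat \<Rightarrow> real) \<Rightarrow> bool" where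
  "slowly_varying f \<longleftrightarrow>
     (\<forall>\<^sub>F n in sequentially. f n > 0) \<and>
     (\<forall>c>0. (\<lambda>n. f (nat \<lfloor>c * real n\<rfloor>) / f n) \<longlonglongrightarrow> 1)"

end

theory Submission
  imports Defs "HOL-Real_Asymp.Real_Asymp"
begin

text \<open>
  Write \<open>w\<^sub>k = Q g + \<dots> + Q\<^sup>k g\<close>, so that \<open>E(S\<^sub>k | F\<^sub>0) = w\<^sub>k(X\<^sub>0)\<close> by the Markov property. Conditioning the
  second block of \<open>S\<^sub>n\<^sub>+\<^sub>m\<close> on the first gives
  \<open>\<bar>\<sigma>\<^sup>2(n + m) - \<sigma>\<^sup>2(n) - \<sigma>\<^sup>2(m)\<bar> \<le> 2 \<sigma>(n) \<parallel>w\<^sub>m\<parallel>\<close>; if \<open>\<parallel>w\<^sub>m\<parallel> = o(\<sigma>(m))\<close>, then \<open>\<sigma>\<^sup>2\<close> is almost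
  additive, hence regularly varying with exponent 1 and almost monotone.

  The function \<open>h\<^sub>n = g + (w\<^sub>1 + \<dots> + w\<^sub>n\<^sub>-\<^sub>1)/n\<close> satisfies \<open>Q h\<^sub>n = (w\<^sub>1 + \<dots> + w\<^sub>n)/n\<close> and
  \<open>(I - Q) h\<^sub>n - g = -w\<^sub>n/n\<close>, so it solves Poisson's equation approximately. Any approximate
  solution \<open>h\<close> yields the martingale differences \<open>h(X\<^sub>j) - Q h(X\<^sub>j\<^sub>-\<^sub>1)\<close>, whose sums differ from \<open>S\<^sub>k\<close> by a
  telescoping term and \<open>k\<close> residuals. Conversely, a martingale approximation has
  \<open>E(M\<^sub>n\<^sub>n | F\<^sub>0) = 0\<close>, so \<open>\<parallel>w\<^sub>n\<parallel> \<le> \<parallel>S\<^sub>n - M\<^sub>n\<^sub>n\<parallel>\<close>.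

  A nontriangular approximation takes \<open>D\<^sub>j\<close> from the array at \<open>n = 2\<^sup>p\<close> for the least \<open>p\<close> with
  \<open>j \<le> 2\<^sup>p\<close>. Its error up to time \<open>2\<^sup>i\<close> grows by at most twice the error of the \<open>2\<^sup>i\<close>-th row at each step,
  which is negligible because \<open>\<sigma>(2\<^sup>i)\<close> grows geometrically.
\<close>

section \<open>Square-integrable functions\<close>

lemma in_L2_integrable_mult:
  assumes "in_L2 M f" "in_L2 M g"
  shows "integrable M (\<lambda>x. f x * g x)"
proof (rule Bochner_Integration.integrable_bound)
  show "integrable M (\<lambda>x. (f x)\<^sup>2 + (g x)\<^sup>2)" using assms by (simp add: in_L2_def)
  show "(\<lambda>x. f x * g x) \<in> borel_measurable M" using assms by (auto simp: in_L2_def)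
  have "\<bar>a * b\<bar> \<le> a\<^sup>2 + b\<^sup>2" for a b :: real
  proof -
    have "0 \<le> \<bar>a * b\<bar>" by simp
    with sum_squares_bound[of "\<bar>a\<bar>" "\<bar>b\<bar>"] show ?thesis
      unfolding abs_mult power2_abs by linarith
  qed
  thus "AE x in M. norm (f x * g x) \<le> norm ((f x)\<^sup>2 + (g x)\<^sup>2)" by simp
qed

lemma in_L2_add [intro]:
  assumes "in_L2 M f" "in_L2 M g" shows "in_L2 M (\<lambda>x. f x + g x)"
  using assms in_L2_integrable_mult[OF assms] by (auto simp: in_L2_def power2_sum mult.assoc)

lemma in_L2_cmult [intro]: "in_L2 M f \<Longrightarrow> in_L2 M (\<lambda>x. c * f x)"
  by (auto simp: in_L2_def power_mult_distrib)

lemma in_L2_divide [intro]: "in_L2 M f \<Longrightarrow> in_L2 M (\<lambda>x. f x / c)"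
  using in_L2_cmult[of M f "inverse c"] by (simp add: divide_inverse mult.commute)

lemma in_L2_minus [intro]: "in_L2 M f \<Longrightarrow> in_L2 M (\<lambda>x. - f x)"
  by (simp add: in_L2_def)

lemma in_L2_diff [intro]:
  assumes "in_L2 M f" "in_L2 M g" shows "in_L2 M (\<lambda>x. f x - g x)"
  using in_L2_add[OF assms(1) in_L2_minus[OF assms(2)]] by simp

lemma in_L2_zero: "in_L2 M (\<lambda>x. 0)"
  by (simp add: in_L2_def)

lemma in_L2_sum [intro]:
  "(\<And>i. i \<in> I \<Longrightarrow> in_L2 M (f i)) \<Longrightarrow> in_L2 M (\<lambda>x. \<Sum>i\<in>I. f i x)"
  by (induction I rule: infinite_finite_induct) (auto simp: in_L2_zero)

lemma in_L2_AE_cong: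
  assumes "in_L2 M f" "AE x in M. f x = g x" "g \<in> borel_measurable M"
  shows "in_L2 M g"
proof -
  have "integrable M (\<lambda>x. (f x)\<^sup>2) \<longleftrightarrow> integrable M (\<lambda>x. (g x)\<^sup>2)"
    by (rule integrable_cong_AE) (use assms in \<open>auto simp: in_L2_def\<close>)
  thus ?thesis using assms by (simp add: in_L2_def)
qed

section \<open>The norm of L2 and the Cauchy-Schwarz inequality\<close>

lemma norm_L2_nonneg [simp]: "norm_L2 M f \<ge> 0"
  by (simp add: norm_L2_def)

lemma norm_L2_sq: "(norm_L2 M f)\<^sup>2 = (\<integral>x. (f x)\<^sup>2 \<partial>M)"
  by (simp add: norm_L2_def)

lemma norm_L2_AE_cong:
  assumes "AE x in M. f x = g x" "f \<in> borel_measurable M" "g \<in> borel_measurable M"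
  shows "norm_L2 M f = norm_L2 M g"
  unfolding norm_L2_def
  by (rule arg_cong[where f = sqrt], rule integral_cong_AE) (use assms in auto)

lemma norm_L2_cmult: "norm_L2 M (\<lambda>x. c * f x) = \<bar>c\<bar> * norm_L2 M f"
  by (simp add: norm_L2_def power_mult_distrib real_sqrt_mult)

lemma norm_L2_minus: "norm_L2 M (\<lambda>x. - f x) = norm_L2 M f"
  by (simp add: norm_L2_def)

lemma norm_L2_divide: "norm_L2 M (\<lambda>x. f x / c) = norm_L2 M f / \<bar>c\<bar>"
  using norm_L2_cmult[of M "inverse c" f] by (simp add: divide_inverse mult.commute)

lemma in_L2_square_add:
  assumes "in_L2 M f" "in_L2 M g"
  shows "(\<integral>x. (f x + g x)\<^sup>2 \<partial>M) = (\<integral>x. (f x)\<^sup>2 \<partial>M) + (\<integral>x. (g x)\<^sup>2 \<partial>M) + 2 * (\<integral>x. f x * g x \<partial>M)"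
  using assms in_L2_integrable_mult[OF assms] by (simp add: in_L2_def power2_sum mult.assoc)

text \<open>The quadratic form sending (s, t) to the integral of (s f + t g)^2 is nonnegative, so
  its discriminant cannot be positive. The case \<open>c = 0\<close> is separate because the
  minimising direction degenerates there.\<close>

lemma in_L2_Cauchy_Schwarz:
  assumes f: "in_L2 M f" and g: "in_L2 M g"
  shows "\<bar>\<integral>x. f x * g x \<partial>M\<bar> \<le> norm_L2 M f * norm_L2 M g"
proof -
  define a b c where "a = (\<integral>x. (f x)\<^sup>2 \<partial>M)" and "b = (\<integral>x. f x * g x \<partial>M)" and "c = (\<integral>x. (g x)\<^sup>2 \<partial>M)"
  have quad: "0 \<le> a * s\<^sup>2 + c * t\<^sup>2 + 2 * (s * t * b)" for s t :: real
  proof -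
    have "0 \<le> (\<integral>x. (s * f x + t * g x)\<^sup>2 \<partial>M)" by simp
    also have "\<dots> = (\<integral>x. (s * f x)\<^sup>2 \<partial>M) + (\<integral>x. (t * g x)\<^sup>2 \<partial>M) + 2 * (\<integral>x. s * f x * (t * g x) \<partial>M)"
      by (intro in_L2_square_add in_L2_cmult f g)
    also have "(\<integral>x. s * f x * (t * g x) \<partial>M) = (\<integral>x. s * t * (f x * g x) \<partial>M)"
      by (simp add: ac_simps)
    finally show ?thesis by (simp add: a_def b_def c_def power_mult_distrib mult.commute)
  qed
  have a0: "a \<ge> 0" and c0: "c \<ge> 0" by (simp_all add: a_def c_def)
  have "b\<^sup>2 \<le> a * c"
  proof (cases "c = 0")
    case True
    have "b = 0"
    proof (rule ccontr)
      assume "b \<noteq> 0"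
      \<comment> \<open>With \<open>c = 0\<close> the form is linear in t, and t = -(a + 1)/b turns
        it into the negative number -a - 2.\<close>
      have "0 \<le> a - 2 * (a + 1)"
        using quad[of 1 "- (a + 1) / b"] True \<open>b \<noteq> 0\<close> by simp
      thus False using a0 by simp
    qed
    thus ?thesis using True by simp
  next
    case False
    \<comment> \<open>For s = c the form is minimal at t = -b, where its value is c (a c -
      b^2).\<close>
    have "0 \<le> c * (a * c - b\<^sup>2)"
      using quad[of c "- b"] by (simp add: power2_eq_square algebra_simps)
    thus ?thesis using False c0 by (simp add: zero_le_mult_iff)
  qed
  hence "sqrt (b\<^sup>2) \<le> sqrt (a * c)" by (rule real_sqrt_le_mono)
  thus ?thesis by (simp add: a_def b_def c_def norm_L2_def real_sqrt_mult)
qed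

lemma norm_L2_add:
  assumes "in_L2 M f" "in_L2 M g"
  shows "norm_L2 M (\<lambda>x. f x + g x) \<le> norm_L2 M f + norm_L2 M g"
proof (rule power2_le_imp_le)
  show "(norm_L2 M (\<lambda>x. f x + g x))\<^sup>2 \<le> (norm_L2 M f + norm_L2 M g)\<^sup>2"
    using in_L2_Cauchy_Schwarz[OF assms]
    by (simp add: power2_sum[of "norm_L2 M f"] norm_L2_sq in_L2_square_add[OF assms])
qed simp

lemma norm_L2_diff:
  assumes "in_L2 M f" "in_L2 M g"
  shows "norm_L2 M (\<lambda>x. f x - g x) \<le> norm_L2 M f + norm_L2 M g"
  using norm_L2_add[OF assms(1) in_L2_minus[OF assms(2)]] by (simp add: norm_L2_minus)

lemma norm_L2_sum:
  assumes "\<And>i. i \<in> I \<Longrightarrow> in_L2 M (f i)"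
  shows "norm_L2 M (\<lambda>x. \<Sum>i\<in>I. f i x) \<le> (\<Sum>i\<in>I. norm_L2 M (f i))"
  using assms
proof (induction I rule: infinite_finite_induct)
  case (insert i I)
  have "norm_L2 M (\<lambda>x. f i x + (\<Sum>i\<in>I. f i x)) \<le> norm_L2 M (f i) + norm_L2 M (\<lambda>x. \<Sum>i\<in>I. f i x)"
    by (intro norm_L2_add in_L2_sum insert.prems) auto
  with insert show ?case by fastforce
qed (simp_all add: norm_L2_def)

lemma norm_L2_sum_bound:
  assumes "\<And>i. i \<in> I \<Longrightarrow> in_L2 M (f i)" "\<And>i. i \<in> I \<Longrightarrow> norm_L2 M (f i) \<le> B"
  shows "norm_L2 M (\<lambda>x. \<Sum>i\<in>I. f i x) \<le> real (card I) * B"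
  using norm_L2_sum[OF assms(1)] sum_bounded_above[OF assms(2), of I] by fastforce

section \<open>Integrability and conditional expectation in L2\<close>

lemma (in finite_measure) in_L2_integrable:
  assumes "in_L2 M f" shows "integrable M f"
proof -
  have "in_L2 M (\<lambda>_. 1)" by (simp add: in_L2_def)
  from in_L2_integrable_mult[OF assms this] show ?thesis by simp
qed

text \<open>Conditional Jensen for the square gives E(f | F)^2 \<le> E(f^2 | F) almost everywhere;
  integrating this yields both claims, because conditional expectation preserves the integral of
  f^2.\<close>

lemma (in sigma_finite_subalgebra) real_cond_exp_L2:
  assumes f: "in_L2 M f" and int: "integrable M f"
  shows "in_L2 M (real_cond_exp M F f)" "norm_L2 M (real_cond_exp M F f) \<le> norm_L2 M f"
proof -
  have f2: "integrable M (\<lambda>x. (f x)\<^sup>2)" using f by (simp add: in_L2_def)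
  have AE: "AE x in M. (real_cond_exp M F f x)\<^sup>2 \<le> real_cond_exp M F (\<lambda>x. (f x)\<^sup>2) x"
    by (rule real_cond_exp_jensens_inequality(2)[OF int, where I = UNIV])
       (use f2 convex_power2 in auto)
  have int2: "integrable M (\<lambda>x. (real_cond_exp M F f x)\<^sup>2)"
    by (rule Bochner_Integration.integrable_bound[OF real_cond_exp_int(1)[OF f2]])
       (use AE in \<open>auto elim: eventually_mono\<close>)
  thus "in_L2 M (real_cond_exp M F f)" by (simp add: in_L2_def)
  have "(\<integral>x. (real_cond_exp M F f x)\<^sup>2 \<partial>M) \<le> (\<integral>x. real_cond_exp M F (\<lambda>x. (f x)\<^sup>2) x \<partial>M)"
    by (rule integral_mono_AE[OF int2 real_cond_exp_int(1)[OF f2] AE])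
  thus "norm_L2 M (real_cond_exp M F f) \<le> norm_L2 M f"
    using real_cond_exp_int(2)[OF f2] by (simp add: norm_L2_def)
qed

section \<open>Almost additive sequences\<close>

text \<open>Replaces floor(c n) and n by multiples of one block length \<open>m\<close>. Rounding c
  q down costs one multiple and the remainder of n another, since (p + 1)(m + 1) \<le> (p + 2) m
  once m \<ge> p + 1; likewise n < q (m + 1) \<le> (q + 1) m uses m \<ge> q.\<close>

lemma sandwich_floor:
  fixes c :: real and n q m p :: nat
  assumes c: "c > 0" and q: "q > 0" and m: "m = n div q" and p: "p = nat \<lfloor>c * real q\<rfloor>"
    and large: "m \<ge> q" "m \<ge> Suc p"
  shows "p * m \<le> nat \<lfloor>c * real n\<rfloor>" "nat \<lfloor>c * real n\<rfloor> \<le> (p + 2) * m"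
    "q * m \<le> n" "n \<le> (q + 1) * m"
proof -
  have qm: "q * m \<le> n" using m by (simp add: mult.commute)
  have nq: "n < q * (m + 1)" using m q by (metis Suc_eq_plus1 dividend_less_times_div mult_Suc_right add.commute)
  show "q * m \<le> n" by (fact qm)
  show "n \<le> (q + 1) * m" using nq large by (simp add: algebra_simps)
  have p1: "real p \<le> c * real q" and p2: "c * real q < real p + 1"
  proof -
    have "real p = of_int \<lfloor>c * real q\<rfloor>" using p c by simp
    thus "real p \<le> c * real q" "c * real q < real p + 1" by linarith+
  qed
  have "real p * real m \<le> c * real q * real m" using p1 by (intro mult_right_mono) auto
  also have "\<dots> = c * real (q * m)" by simp
  also have "\<dots> \<le> c * real n" using qm c by (intro mult_left_mono) (auto simp del: of_nat_mult)
  finally show "p * m \<le> nat \<lfloor>c * real n\<rfloor>"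
    by (simp add: le_nat_floor)
  have "c * real n \<le> c * real (q * (m + 1))" using nq c by (intro mult_left_mono) (auto simp del: of_nat_mult)
  also have "\<dots> = c * real q * real (m + 1)" by (simp only: of_nat_mult mult.assoc)
  also have "\<dots> \<le> (real p + 1) * real (m + 1)" using p2 by (intro mult_right_mono) auto
  also have "\<dots> = real ((p + 1) * (m + 1))" by (simp add: algebra_simps)
  finally have "\<lfloor>c * real n\<rfloor> \<le> int ((p + 1) * (m + 1))" by (simp add: floor_le_iff)
  hence "nat \<lfloor>c * real n\<rfloor> \<le> (p + 1) * (m + 1)" by linarith
  also have "\<dots> \<le> (p + 2) * m" using large by (simp add: algebra_simps)
  finally show "nat \<lfloor>c * real n\<rfloor> \<le> (p + 2) * m" .
qed

text \<open>Meant for A \<le> t C and B \<le> t D multiplied together: two almost-monotone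
  comparisons, one for the numerator and one for the denominator, combine into a bound for the
  quotient.\<close>

lemma ratio_bound:
  fixes A B C D t :: real
  assumes "A * B \<le> (t * C) * (t * D)" "B > 0" "D > 0"
  shows "A / D \<le> t\<^sup>2 * (C / B)"
proof -
  have "A / D = (A * B) / (B * D)" using assms by simp
  also have "\<dots> \<le> ((t * C) * (t * D)) / (B * D)" using assms by (intro divide_right_mono) auto
  also have "\<dots> = t\<^sup>2 * (C / B)" using assms by (simp add: power2_eq_square)
  finally show ?thesis .
qed

text \<open>The increments are o(v) and v eventually grows by a fixed factor, so their sum behaves
  like a geometric series dominated by its last terms.\<close>

lemma geometric_smallo:
  fixes u d v :: "nat \<Rightarrow> real"
  assumes u0: "\<And>i. u i \<ge> 0"
    and step: "\<And>i. u (Suc i) \<le> u i + d (Suc i)"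
    and d: "d \<in> o(v)" and v0: "\<And>i. v i \<ge> 0"
    and growth: "\<forall>\<^sub>F i in sequentially. v (Suc i) \<ge> 4/3 * v i"
    and v: "filterlim v at_top sequentially"
  shows "u \<in> o(v)"
proof (rule landau_o.smallI)
  fix c :: real assume c: "c > 0"
  have "\<forall>\<^sub>F i in sequentially. norm (d i) \<le> c/8 * norm (v i)"
    using landau_o.smallD[OF d, of "c/8"] c by simp
  with growth have "\<forall>\<^sub>F i in sequentially. v (Suc i) \<ge> 4/3 * v i \<and> d i \<le> c/8 * v i"
    by eventually_elim (use v0 in \<open>force simp: abs_le_iff\<close>)
  then obtain K where K: "\<And>i. i \<ge> K \<Longrightarrow> v (Suc i) \<ge> 4/3 * v i \<and> d i \<le> c/8 * v i"
    unfolding eventually_sequentially by blast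
  \<comment> \<open>With increments at most c/8 times v and growth 4/3, the level c/2 reproduces
    itself: c/2 of \<open>v i\<close> is at most 3c/8 of \<open>v (Suc i)\<close>, which leaves room
    for exactly one increment. The starting value \<open>u K\<close> is absorbed at the end because
    v tends to infinity.\<close>
  have ind: "u i \<le> u K + c/2 * v i" if "i \<ge> K" for i
    using that
  proof (induction i rule: dec_induct)
    case base
    show ?case using v0[of K] c by simp
  next
    case (step i)
    have "c/2 * v i \<le> 3*c/8 * v (Suc i)"
      using K[of i] step.hyps c mult_left_mono[of "4/3 * v i" "v (Suc i)" "3*c/8"] by auto
    with assms(2)[of i] K[of "Suc i"] step show ?case by (auto simp: algebra_simps)
  qed
  have "\<forall>\<^sub>F i in sequentially. v i \<ge> 2 * u K / c"
    using v by (simp add: filterlim_at_top)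
  with eventually_ge_at_top[of K] show "\<forall>\<^sub>F i in sequentially. norm (u i) \<le> c * norm (v i)"
  proof eventually_elim
    case (elim i)
    have "u K \<le> c/2 * v i" using elim(2) c by (simp add: field_simps)
    with ind[OF elim(1)] u0[of i] v0[of i] show ?case by (simp add: field_simps)
  qed
qed

text \<open>Isolates the analytic part of the argument: \<open>s n\<close> stands for sigma_n and
  \<open>e m\<close> for the norm of E(S_m | X_0). The growth of the variance is derived from these
  properties alone.\<close>

locale almost_additive =
  fixes s e :: "nat \<Rightarrow> real"
  assumes s_nonneg: "s n \<ge> 0"
    and s_add: "\<bar>(s (n + m))\<^sup>2 - (s n)\<^sup>2 - (s m)\<^sup>2\<bar> \<le> 2 * s n * e m"
    and e_small: "e \<in> o(s)"
    and s_inf: "filterlim s at_top sequentially"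
begin

lemma s_large: "\<forall>\<^sub>F n in sequentially. s n \<ge> C"
  using s_inf by (simp add: filterlim_at_top)

text \<open>By 2ab \<le> a^2 + b^2 the mixed bound becomes one relative to the sum of squares. The
  threshold concerns m only, so the estimate is uniform in n.\<close>

lemma almost_add:
  assumes "\<epsilon> > 0"
  shows "\<forall>\<^sub>F m in sequentially. \<forall>n. \<bar>(s (n + m))\<^sup>2 - (s n)\<^sup>2 - (s m)\<^sup>2\<bar> \<le> \<epsilon> * ((s n)\<^sup>2 + (s m)\<^sup>2)"
  using landau_o.smallD[OF e_small assms]
proof eventually_elim
  case (elim m)
  have em: "e m \<le> \<epsilon> * s m" using elim s_nonneg[of m] by simp
  show ?case
  proof
    fix n
    have "2 * s n * e m \<le> 2 * s n * (\<epsilon> * s m)" using em s_nonneg[of n] by (intro mult_left_mono) auto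
    also have "\<dots> = \<epsilon> * (2 * s n * s m)" by simp
    also have "\<dots> \<le> \<epsilon> * ((s n)\<^sup>2 + (s m)\<^sup>2)"
      using assms by (intro mult_left_mono sum_squares_bound) auto
    finally show "\<bar>(s (n + m))\<^sup>2 - (s n)\<^sup>2 - (s m)\<^sup>2\<bar> \<le> \<epsilon> * ((s n)\<^sup>2 + (s m)\<^sup>2)"
      using s_add[of n m] by linarith
  qed
qed

text \<open>Write n = (n - k) + k, apply almost additivity with m = k and drop the nonnegative
  contribution of n - k. This works for k beyond a threshold; the finitely many smaller k are beaten
  because s tends to infinity.\<close>

lemma almost_mono_sq:
  assumes "\<delta> > 0"
  shows "\<forall>\<^sub>F n in sequentially. \<forall>k\<le>n. (s k)\<^sup>2 \<le> (1 + \<delta>) * (s n)\<^sup>2"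
proof -
  \<comment> \<open>Chosen so that the relative loss \<open>1 - \<epsilon>\<close> is the reciprocal
    of \<open>1 + \<delta>\<close>.\<close>
  define \<epsilon> where "\<epsilon> = \<delta> / (1 + \<delta>)"
  have \<epsilon>: "\<epsilon> > 0" "(1 - \<epsilon>) * (1 + \<delta>) = 1" "\<epsilon> < 1" using assms by (auto simp: \<epsilon>_def field_simps)
  obtain K where K: "\<And>m n. m \<ge> K \<Longrightarrow> \<bar>(s (n + m))\<^sup>2 - (s n)\<^sup>2 - (s m)\<^sup>2\<bar> \<le> \<epsilon> * ((s n)\<^sup>2 + (s m)\<^sup>2)"
    using almost_add[OF \<epsilon>(1)] unfolding eventually_sequentially by blast
  have big: "(s k)\<^sup>2 \<le> (1 + \<delta>) * (s n)\<^sup>2" if "k \<ge> K" "k \<le> n" for k n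
  proof -
    have "(1 - \<epsilon>) * ((s (n - k))\<^sup>2 + (s k)\<^sup>2) \<le> (s n)\<^sup>2"
      using K[OF that(1), of "n - k"] that(2) by (simp add: algebra_simps abs_le_iff)
    moreover have "(1 - \<epsilon>) * (s k)\<^sup>2 \<le> (1 - \<epsilon>) * ((s (n - k))\<^sup>2 + (s k)\<^sup>2)"
      using \<epsilon> by (intro mult_left_mono) auto
    ultimately have "(1 - \<epsilon>) * (s k)\<^sup>2 \<le> (s n)\<^sup>2" by linarith
    hence "(1 + \<delta>) * ((1 - \<epsilon>) * (s k)\<^sup>2) \<le> (1 + \<delta>) * (s n)\<^sup>2" using assms by (intro mult_left_mono) auto
    thus ?thesis using \<epsilon>(2) by (simp add: mult.assoc[symmetric] mult.commute[of "1 + \<delta>" "1 - \<epsilon>"])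
  qed
  have "\<forall>\<^sub>F n in sequentially. \<forall>k\<in>{..<K}. s k \<le> s n"
    by (intro eventually_ball_finite ballI s_large) simp
  thus ?thesis
  proof eventually_elim
    case (elim n)
    show ?case
    proof (intro allI impI)
      fix k assume k: "k \<le> n"
      show "(s k)\<^sup>2 \<le> (1 + \<delta>) * (s n)\<^sup>2"
      proof (cases "k < K")
        case True
        hence "(s k)\<^sup>2 \<le> (s n)\<^sup>2" using elim s_nonneg by (intro power_mono) auto
        moreover have "\<delta> * (s n)\<^sup>2 \<ge> 0" using assms by simp
        ultimately show ?thesis by (simp add: algebra_simps)
      qed (use big k in auto)
    qed
  qed
qed

lemma almost_mono: "\<forall>\<^sub>F n in sequentially. \<forall>k\<le>n. s k \<le> 2 * s n"
proof -
  have "\<forall>\<^sub>F n in sequentially. \<forall>k\<le>n. (s k)\<^sup>2 \<le> (1 + 3) * (s n)\<^sup>2"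
    by (rule almost_mono_sq) simp
  thus ?thesis
  proof eventually_elim
    case (elim n)
    show ?case
    proof (intro allI impI)
      fix k assume "k \<le> n"
      with elim have "(s k)\<^sup>2 \<le> (1 + 3) * (s n)\<^sup>2" by blast
      also have "\<dots> = (2 * s n)\<^sup>2" by (simp add: power2_eq_square)
      finally show "s k \<le> 2 * s n" by (rule power2_le_imp_le) (simp add: s_nonneg)
    qed
  qed
qed

text \<open>Upgrades a little-o relation at n to one for all k \<le> n at once. For large k the
  constant c/2 absorbs the factor 2 of \<open>almost_mono\<close>; the remaining finitely many
  values are dominated as \<open>s n\<close> grows.\<close>

lemma smallo_uniform:
  fixes f :: "nat \<Rightarrow> real"
  assumes f: "f \<in> o(s)" and c: "c > 0"
  shows "\<forall>\<^sub>F n in sequentially. \<forall>k\<le>n. f k \<le> c * s n"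
proof -
  have "\<forall>\<^sub>F k in sequentially. norm (f k) \<le> c/2 * norm (s k)"
    using landau_o.smallD[OF f, of "c/2"] c by simp
  then obtain K where K: "\<And>k. k \<ge> K \<Longrightarrow> norm (f k) \<le> c/2 * norm (s k)"
    unfolding eventually_sequentially by blast
  have "\<forall>\<^sub>F n in sequentially. \<forall>k\<in>{..<K}. f k / c \<le> s n"
    by (intro eventually_ball_finite ballI s_large) simp
  with almost_mono show ?thesis
  proof eventually_elim
    case (elim n)
    show ?case
    proof (intro allI impI)
      fix k assume k: "k \<le> n"
      show "f k \<le> c * s n"
      proof (cases "k < K")
        case True
        hence "f k / c \<le> s n" using elim(2) by simp
        thus ?thesis using c by (simp add: pos_divide_le_eq mult.commute)
      next
        case False
        hence "f k \<le> c/2 * s k" using K[of k] s_nonneg[of k] by simp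
        also have "s k \<le> 2 * s n" using elim(1) k by blast
        hence "c/2 * s k \<le> c/2 * (2 * s n)" using c by (intro mult_left_mono) simp_all
        finally show ?thesis by simp
      qed
    qed
  qed
qed

text \<open>One more block of length n raises the squared ratio by 1, up to the error 2 s(k n) e(n)
  / s(n)^2 = 2 sqrt(b n) e(n) / s(n). The factor sqrt(b n) converges by the induction hypothesis,
  and e(n) / s(n) vanishes.\<close>

lemma multiple_ratio:
  assumes "k \<ge> 1"
  shows "(\<lambda>n. (s (k * n))\<^sup>2 / (s n)\<^sup>2) \<longlonglongrightarrow> real k"
  using assms
proof (induction k rule: dec_induct)
  case base
  have "\<forall>\<^sub>F n in sequentially. (s (1 * n))\<^sup>2 / (s n)\<^sup>2 = real 1"
    using s_large[of 1] by eventually_elim auto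
  thus ?case by (simp add: tendsto_eventually)
next
  case (step k)
  define b where "b = (\<lambda>n. (s (k * n))\<^sup>2 / (s n)\<^sup>2)"
  have b: "b \<longlonglongrightarrow> real k" using step by (simp add: b_def)
  have "(\<lambda>n. (s (Suc k * n))\<^sup>2 / (s n)\<^sup>2 - b n - 1) \<longlonglongrightarrow> 0"
  proof (rule Lim_null_comparison)
    show "\<forall>\<^sub>F n in sequentially. norm ((s (Suc k * n))\<^sup>2 / (s n)\<^sup>2 - b n - 1) \<le> 2 * sqrt (b n) * (norm (e n / s n))"
      using s_large[of 1]
    proof eventually_elim
      case (elim n)
      have pos: "s n > 0" using elim by simp
      have "\<bar>(s (Suc k * n))\<^sup>2 / (s n)\<^sup>2 - b n - 1\<bar> = \<bar>((s (k * n + n))\<^sup>2 - (s (k * n))\<^sup>2 - (s n)\<^sup>2) / (s n)\<^sup>2\<bar>"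
        using pos by (simp add: b_def diff_divide_distrib add.commute)
      also have "\<dots> = \<bar>(s (k * n + n))\<^sup>2 - (s (k * n))\<^sup>2 - (s n)\<^sup>2\<bar> / (s n)\<^sup>2"
        by simp
      also have "\<dots> \<le> 2 * s (k * n) * e n / (s n)\<^sup>2"
        using s_add[of "k * n" n] by (intro divide_right_mono) auto
      also have "\<dots> = 2 * sqrt (b n) * (e n / s n)"
        using s_nonneg pos by (simp add: b_def real_sqrt_divide power2_eq_square)
      also have "\<dots> \<le> 2 * sqrt (b n) * norm (e n / s n)"
        by (intro mult_left_mono) (simp_all add: b_def del: norm_divide abs_divide)
      finally show ?case by simp
    qed
    have "(\<lambda>n. norm (e n / s n)) \<longlonglongrightarrow> 0"
      using smalloD_tendsto[OF e_small] tendsto_norm_zero by blast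
    with b have "(\<lambda>n. 2 * sqrt (b n) * norm (e n / s n)) \<longlonglongrightarrow> 2 * sqrt (real k) * 0"
      by (intro tendsto_intros)
    thus "(\<lambda>n. 2 * sqrt (b n) * norm (e n / s n)) \<longlonglongrightarrow> 0" by simp
  qed
  from tendsto_add[OF tendsto_add[OF this b] tendsto_const[of 1]] show ?case
    by (simp add: ac_simps del: mult_Suc)
qed

section \<open>Regular and slow variation\<close>

lemma filterlim_div_at_top:
  assumes "q > 0"
  shows "filterlim (\<lambda>n::nat. n div q) at_top sequentially"
  using assms by (simp add: filterlim_at_top_div_const_nat)

text \<open>For fixed q, floor(c n) and n are enclosed between multiples of \<open>n div q\<close>.
  Almost monotonicity moves s to these multiples, and \<open>multiple_ratio\<close> gives the limits
  (p + 2)/q above and p/(q + 1) below. Keeping q fixed here allows it to be sent to infinity after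
  n.\<close>

lemma regularly_varying_bounds:
  fixes c :: real and q :: nat
  assumes c: "c > 0" and q: "q > 0"
  shows "(1 + 1 / real q)\<^sup>2 * ((c * real q + 2) / real q) < U \<Longrightarrow>
      \<forall>\<^sub>F n in sequentially. (s (nat \<lfloor>c * real n\<rfloor>))\<^sup>2 / (s n)\<^sup>2 < U"
    and "L < ((c * real q - 1) / real (q + 1)) / (1 + 1 / real q)\<^sup>2 \<Longrightarrow>
      \<forall>\<^sub>F n in sequentially. L < (s (nat \<lfloor>c * real n\<rfloor>))\<^sup>2 / (s n)\<^sup>2"
proof -
  have fl: "filterlim (\<lambda>n. nat \<lfloor>c * real n\<rfloor>) at_top sequentially"
    using c by real_asymp
  define p where "p = nat \<lfloor>c * real q\<rfloor>"
  \<comment> \<open>Tying the loss in almost monotonicity to q leaves a single parameter. The loss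
    enters once for the numerator and once for the denominator, hence the squares.\<close>
  define \<delta> where "\<delta> = 1 / real q"
  have \<delta>: "\<delta> > 0" using q by (simp add: \<delta>_def)
  note fm = filterlim_div_at_top[OF q]
  have big: "\<forall>\<^sub>F n in sequentially. n div q \<ge> q + p + 1"
    using fm by (simp add: filterlim_at_top)
  have mono: "\<forall>\<^sub>F n in sequentially. \<forall>k\<le>n. (s k)\<^sup>2 \<le> (1 + \<delta>) * (s n)\<^sup>2"
    by (rule almost_mono_sq[OF \<delta>])
  have mult: "filterlim (\<lambda>n. k * (n div q)) at_top sequentially" if "k > 0" for k
    using filterlim_compose[OF mult_nat_left_at_top[OF that] fm] .
  have m1: "\<forall>\<^sub>F n in sequentially. \<forall>k\<le>nat \<lfloor>c * real n\<rfloor>. (s k)\<^sup>2 \<le> (1 + \<delta>) * (s (nat \<lfloor>c * real n\<rfloor>))\<^sup>2"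
    using mono fl by (rule eventually_compose_filterlim)
  have m2: "\<forall>\<^sub>F n in sequentially. \<forall>k\<le>(p+2) * (n div q). (s k)\<^sup>2 \<le> (1 + \<delta>) * (s ((p+2) * (n div q)))\<^sup>2"
    using mono mult by (rule eventually_compose_filterlim) simp
  have m3: "\<forall>\<^sub>F n in sequentially. \<forall>k\<le>(q+1) * (n div q). (s k)\<^sup>2 \<le> (1 + \<delta>) * (s ((q+1) * (n div q)))\<^sup>2"
    using mono mult by (rule eventually_compose_filterlim) simp
  have posn: "\<forall>\<^sub>F n in sequentially. s n > 0" using s_large[of 1] by eventually_elim auto
  have posm: "\<forall>\<^sub>F n in sequentially. s (n div q) > 0" using posn fm by (rule eventually_compose_filterlim)
  have posq: "\<forall>\<^sub>F n in sequentially. s (q * (n div q)) > 0" using posn mult[OF q] by (rule eventually_compose_filterlim)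
  have ratio: "(\<lambda>n. (s (k * (n div q)))\<^sup>2 / (s (n div q))\<^sup>2) \<longlonglongrightarrow> real k" if "k \<ge> 1" for k
    using multiple_ratio[OF that] fm by (rule filterlim_compose)
  \<comment> \<open>Dividing by the value at \<open>n div q\<close> turns a quotient of two
    multiples into a quotient of two ratios covered by \<open>multiple_ratio\<close>.\<close>
  have cancel: "a / b = (a / x) / (b / x)" if "x \<noteq> 0" for a b x :: real
    using that by simp
  have upper: "\<forall>\<^sub>F n in sequentially. (s (nat \<lfloor>c * real n\<rfloor>))\<^sup>2 / (s n)\<^sup>2
      \<le> (1 + \<delta>)\<^sup>2 * (((s ((p+2) * (n div q)))\<^sup>2 / (s (n div q))\<^sup>2) / ((s (q * (n div q)))\<^sup>2 / (s (n div q))\<^sup>2))"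
    using big mono m2 posn posm posq
  proof eventually_elim
    case (elim n)
    have sw2: "nat \<lfloor>c * real n\<rfloor> \<le> (p+2) * (n div q)" and sw3: "q * (n div q) \<le> n"
      using sandwich_floor(2,3)[OF c q refl p_def, of n] elim(1) by auto
    have "(s (nat \<lfloor>c * real n\<rfloor>))\<^sup>2 \<le> (1 + \<delta>) * (s ((p+2) * (n div q)))\<^sup>2" using elim(3) sw2 by blast
    moreover have "(s (q * (n div q)))\<^sup>2 \<le> (1 + \<delta>) * (s n)\<^sup>2" using elim(2) sw3 by blast
    ultimately have "(s (nat \<lfloor>c * real n\<rfloor>))\<^sup>2 * (s (q * (n div q)))\<^sup>2
        \<le> ((1 + \<delta>) * (s ((p+2) * (n div q)))\<^sup>2) * ((1 + \<delta>) * (s n)\<^sup>2)"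
      using \<delta> by (intro mult_mono) auto
    moreover have "(s (q * (n div q)))\<^sup>2 > 0" "(s n)\<^sup>2 > 0" using elim(4,6) by auto
    ultimately have "(s (nat \<lfloor>c * real n\<rfloor>))\<^sup>2 / (s n)\<^sup>2
        \<le> (1 + \<delta>)\<^sup>2 * ((s ((p+2) * (n div q)))\<^sup>2 / (s (q * (n div q)))\<^sup>2)"
      by (rule ratio_bound)
    also have "(s ((p+2) * (n div q)))\<^sup>2 / (s (q * (n div q)))\<^sup>2 =
        ((s ((p+2) * (n div q)))\<^sup>2 / (s (n div q))\<^sup>2) / ((s (q * (n div q)))\<^sup>2 / (s (n div q))\<^sup>2)"
      by (rule cancel) (use elim(5) in auto)
    finally show ?case .
  qed
  have lower: "\<forall>\<^sub>F n in sequentially. (s (nat \<lfloor>c * real n\<rfloor>))\<^sup>2 / (s n)\<^sup>2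
      \<ge> (((s (p * (n div q)))\<^sup>2 / (s (n div q))\<^sup>2) / ((s ((q+1) * (n div q)))\<^sup>2 / (s (n div q))\<^sup>2)) / (1 + \<delta>)\<^sup>2"
    using big m1 m3 posn posm eventually_compose_filterlim[OF posn mult[of "q+1", simplified]]
  proof eventually_elim
    case (elim n)
    have sw2: "p * (n div q) \<le> nat \<lfloor>c * real n\<rfloor>" and sw3: "n \<le> (q+1) * (n div q)"
      using sandwich_floor(1,4)[OF c q refl p_def, of n] elim(1) by auto
    have pos6: "s ((q+1) * (n div q)) > 0" using elim(6) by simp
    have "(s (p * (n div q)))\<^sup>2 \<le> (1 + \<delta>) * (s (nat \<lfloor>c * real n\<rfloor>))\<^sup>2" using elim(2) sw2 by blast
    moreover have "(s n)\<^sup>2 \<le> (1 + \<delta>) * (s ((q+1) * (n div q)))\<^sup>2" using elim(3) sw3 by blast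
    ultimately have "(s (p * (n div q)))\<^sup>2 * (s n)\<^sup>2
        \<le> ((1 + \<delta>) * (s (nat \<lfloor>c * real n\<rfloor>))\<^sup>2) * ((1 + \<delta>) * (s ((q+1) * (n div q)))\<^sup>2)"
      using \<delta> by (intro mult_mono) auto
    moreover have "(s n)\<^sup>2 > 0" "(s ((q+1) * (n div q)))\<^sup>2 > 0" using elim(4) pos6 by auto
    ultimately have "(s (p * (n div q)))\<^sup>2 / (s ((q+1) * (n div q)))\<^sup>2
        \<le> (1 + \<delta>)\<^sup>2 * ((s (nat \<lfloor>c * real n\<rfloor>))\<^sup>2 / (s n)\<^sup>2)"
      by (rule ratio_bound)
    also have "(s (p * (n div q)))\<^sup>2 / (s ((q+1) * (n div q)))\<^sup>2 =
        ((s (p * (n div q)))\<^sup>2 / (s (n div q))\<^sup>2) / ((s ((q+1) * (n div q)))\<^sup>2 / (s (n div q))\<^sup>2)"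
      by (rule cancel) (use elim(5) in auto)
    finally show ?case
      using \<delta> by (simp only: pos_divide_le_eq zero_less_power add_pos_pos zero_less_one mult.commute)
  qed
  have "(\<lambda>n. (1 + \<delta>)\<^sup>2 * (((s ((p+2) * (n div q)))\<^sup>2 / (s (n div q))\<^sup>2) / ((s (q * (n div q)))\<^sup>2 / (s (n div q))\<^sup>2)))
      \<longlonglongrightarrow> (1 + \<delta>)\<^sup>2 * (real (p + 2) / real q)"
    by (rule tendsto_mult[OF tendsto_const tendsto_divide[OF ratio ratio]]) (use q in simp_all)
  note limU = this
  have Uq: "(1 + \<delta>)\<^sup>2 * (real (p + 2) / real q) \<le> (1 + \<delta>)\<^sup>2 * ((c * real q + 2) / real q)"
    using c by (intro mult_left_mono divide_right_mono) (auto simp: p_def)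
  have U: "\<forall>\<^sub>F n in sequentially. (s (nat \<lfloor>c * real n\<rfloor>))\<^sup>2 / (s n)\<^sup>2 < U"
    if "(1 + \<delta>)\<^sup>2 * ((c * real q + 2) / real q) < U" for U
    using upper order_tendstoD(2)[OF limU order.strict_trans1[OF Uq that]]
    by eventually_elim (rule order.strict_trans1)
  have L: "\<forall>\<^sub>F n in sequentially. L < (s (nat \<lfloor>c * real n\<rfloor>))\<^sup>2 / (s n)\<^sup>2"
    if "L < ((c * real q - 1) / real (q + 1)) / (1 + \<delta>)\<^sup>2" for L
  proof (cases "p \<ge> 1")
    case True
    have "(\<lambda>n. (((s (p * (n div q)))\<^sup>2 / (s (n div q))\<^sup>2) / ((s ((q+1) * (n div q)))\<^sup>2 / (s (n div q))\<^sup>2)) / (1 + \<delta>)\<^sup>2)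
        \<longlonglongrightarrow> (real p / real (q+1)) / (1 + \<delta>)\<^sup>2"
      by (rule tendsto_divide[OF tendsto_divide[OF ratio ratio] tendsto_const]) (use q \<delta> True in simp_all)
    note limL = this
    have Lq: "((c * real q - 1) / real (q + 1)) / (1 + \<delta>)\<^sup>2 \<le> (real p / real (q+1)) / (1 + \<delta>)\<^sup>2"
      unfolding p_def by (intro divide_right_mono; linarith?) auto
    show ?thesis
      using lower order_tendstoD(1)[OF limL order.strict_trans2[OF that Lq]]
      by eventually_elim (rule order.strict_trans2)
  next
    \<comment> \<open>\<open>multiple_ratio\<close> asks for a positive multiple. If p = 0, then c q
      < 1, the proposed lower bound is not positive, and so L is negative while the quotient is
      not.\<close>
    case False
    hence "c * real q - 1 < 0" using c q unfolding p_def by linarith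
    hence "((c * real q - 1) / real (q + 1)) / (1 + \<delta>)\<^sup>2 \<le> 0"
      by (intro divide_nonpos_nonneg) auto
    with that have "L < 0" by linarith
    thus ?thesis by (intro always_eventually allI) (rule order.strict_trans2, assumption, intro divide_nonneg_nonneg zero_le_power2)
  qed
  show "(1 + 1 / real q)\<^sup>2 * ((c * real q + 2) / real q) < U \<Longrightarrow>
      \<forall>\<^sub>F n in sequentially. (s (nat \<lfloor>c * real n\<rfloor>))\<^sup>2 / (s n)\<^sup>2 < U"
    by (rule U[unfolded \<delta>_def])
  show "L < ((c * real q - 1) / real (q + 1)) / (1 + 1 / real q)\<^sup>2 \<Longrightarrow>
      \<forall>\<^sub>F n in sequentially. L < (s (nat \<lfloor>c * real n\<rfloor>))\<^sup>2 / (s n)\<^sup>2"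
    by (rule L[unfolded \<delta>_def])
qed

text \<open>Both bounds for fixed q tend to c as q grows, so for a given U > c or L < c the
  parameter q is fixed first and n is taken large afterwards.\<close>

lemma regularly_varying:
  assumes c: "c > (0::real)"
  shows "(\<lambda>n. (s (nat \<lfloor>c * real n\<rfloor>))\<^sup>2 / (s n)\<^sup>2) \<longlonglongrightarrow> c"
proof (rule order_tendstoI)
  fix U assume U: "c < U"
  have "(\<lambda>q::nat. (1 + 1 / real q)\<^sup>2 * ((c * real q + 2) / real q)) \<longlonglongrightarrow> c"
    using c by real_asymp
  from order_tendstoD(2)[OF this U] eventually_gt_at_top[of 0]
  have "\<forall>\<^sub>F q in sequentially. q > 0 \<and> (1 + 1 / real q)\<^sup>2 * ((c * real q + 2) / real q) < U"
    by eventually_elim auto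
  then obtain q where "q > 0" "(1 + 1 / real q)\<^sup>2 * ((c * real q + 2) / real q) < U"
    using eventually_happens' trivial_limit_sequentially by blast
  thus "\<forall>\<^sub>F n in sequentially. (s (nat \<lfloor>c * real n\<rfloor>))\<^sup>2 / (s n)\<^sup>2 < U"
    using regularly_varying_bounds(1) c by blast
next
  fix L assume L: "L < c"
  have "(\<lambda>q::nat. ((c * real q - 1) / real (q + 1)) / (1 + 1 / real q)\<^sup>2) \<longlonglongrightarrow> c"
    using c by real_asymp
  from order_tendstoD(1)[OF this L] eventually_gt_at_top[of 0]
  have "\<forall>\<^sub>F q in sequentially. q > 0 \<and> L < ((c * real q - 1) / real (q + 1)) / (1 + 1 / real q)\<^sup>2"
    by eventually_elim auto
  then obtain q where "q > 0" "L < ((c * real q - 1) / real (q + 1)) / (1 + 1 / real q)\<^sup>2"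
    using eventually_happens' trivial_limit_sequentially by blast
  thus "\<forall>\<^sub>F n in sequentially. L < (s (nat \<lfloor>c * real n\<rfloor>))\<^sup>2 / (s n)\<^sup>2"
    using regularly_varying_bounds(2) c by blast
qed

text \<open>The square of s varies regularly with exponent 1, and dividing by n removes the factor c
  because floor(c n)/n tends to c.\<close>

lemma slowly_varying: "slowly_varying (\<lambda>n. (s n)\<^sup>2 / real n)"
  unfolding slowly_varying_def
proof (intro conjI allI impI)
  show "\<forall>\<^sub>F n in sequentially. (s n)\<^sup>2 / real n > 0"
    using s_large[of 1] eventually_gt_at_top[of 0] by eventually_elim auto
  fix c :: real assume c: "c > 0"
  have "(\<lambda>n. ((s (nat \<lfloor>c * real n\<rfloor>))\<^sup>2 / (s n)\<^sup>2) * (real n / real (nat \<lfloor>c * real n\<rfloor>))) \<longlonglongrightarrow> c * (1 / c)"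
  proof (intro tendsto_mult regularly_varying c)
    have "(\<lambda>n. real n / real (nat \<lfloor>c * real n\<rfloor>)) \<longlonglongrightarrow> inverse c"
      using c by real_asymp
    thus "(\<lambda>n. real n / real (nat \<lfloor>c * real n\<rfloor>)) \<longlonglongrightarrow> 1 / c"
      by (simp add: inverse_eq_divide)
  qed
  thus "(\<lambda>n. ((s (nat \<lfloor>c * real n\<rfloor>))\<^sup>2 / real (nat \<lfloor>c * real n\<rfloor>)) / ((s n)\<^sup>2 / real n)) \<longlonglongrightarrow> 1"
    using c by (simp add: mult.commute)
qed

text \<open>The squared ratio tends to 2, which lies strictly between (4/3)^2 = 16/9 and 2^2 = 4;
  \<open>doubling_bound\<close> uses the same limit. The factor 4/3 is the one required by
  \<open>geometric_smallo\<close>.\<close>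

lemma doubling_growth: "\<forall>\<^sub>F n in sequentially. 4/3 * s n \<le> s (2 * n)"
proof -
  have "\<forall>\<^sub>F n in sequentially. 16/9 < (s (2 * n))\<^sup>2 / (s n)\<^sup>2"
    using order_tendstoD(1)[OF multiple_ratio[of 2], of "16/9"] by simp
  with s_large[of 1] show ?thesis
  proof eventually_elim
    case (elim n)
    hence "(4/3 * s n)\<^sup>2 \<le> (s (2 * n))\<^sup>2" by (simp add: field_simps power2_eq_square)
    thus ?case using s_nonneg power2_le_imp_le by blast
  qed
qed

lemma doubling_bound: "\<forall>\<^sub>F n in sequentially. s (2 * n) \<le> 2 * s n"
proof -
  have "\<forall>\<^sub>F n in sequentially. (s (2 * n))\<^sup>2 / (s n)\<^sup>2 < 4"
    using order_tendstoD(2)[OF multiple_ratio[of 2], of 4] by simp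
  with s_large[of 1] show ?thesis
  proof eventually_elim
    case (elim n)
    hence "(s (2 * n))\<^sup>2 \<le> (2 * s n)\<^sup>2" by (simp add: field_simps power2_eq_square)
    thus ?case by (rule power2_le_imp_le) (simp add: s_nonneg)
  qed
qed

end

section \<open>Stationary Markov chains\<close>

locale stationary_chain = prob_space M for M :: "'w measure" +
  fixes N :: "'s measure" and X :: "int \<Rightarrow> 'w \<Rightarrow> 's" and Q :: "'s \<Rightarrow> 's measure"
  assumes markov: "markov_chain M N X"
    and stationary: "stationary_process M N UNIV X"
    and kernel: "regular_cond_distr M N (X 1) (X 0) Q"
begin

lemma X_measurable [measurable]: "X i \<in> measurable M N"
  using markov by (simp add: markov_chain_def)

lemma X_space: "\<omega> \<in> space M \<Longrightarrow> X i \<omega> \<in> space N"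
  using measurable_space[OF X_measurable] .

lemma Q_prob [measurable]: "Q \<in> measurable N (prob_algebra N)"
  using kernel by (simp add: regular_cond_distr_def)

lemma Q_subprob [measurable]: "Q \<in> measurable N (subprob_algebra N)"
  by (rule measurable_prob_algebraD[OF Q_prob])

lemma kernel_op_measurable [measurable]:
  "f \<in> borel_measurable N \<Longrightarrow> kernel_op Q f \<in> borel_measurable N"
  unfolding kernel_op_def[abs_def]
  by (rule measurable_compose[OF Q_subprob integral_measurable_subprob_algebra])

section \<open>Shift invariance of integrals along the path\<close>

lemma path_measurable [measurable]: "(\<lambda>\<omega> i. X (i + k) \<omega>) \<in> measurable M (\<Pi>\<^sub>M i\<in>UNIV. N)"
  by (rule measurable_abs_UNIV) measurable

lemma distr_shift:
  "distr M (\<Pi>\<^sub>M i\<in>UNIV. N) (\<lambda>\<omega> i. X (i + k) \<omega>) = distr M (\<Pi>\<^sub>M i\<in>UNIV. N) (\<lambda>\<omega> i. X i \<omega>)"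
  using stationary by (simp add: stationary_process_def restrict_def)

lemma
  fixes F :: "(int \<Rightarrow> 's) \<Rightarrow> real"
  assumes F [measurable]: "F \<in> borel_measurable (\<Pi>\<^sub>M i\<in>UNIV. N)"
  shows integral_shift: "(\<integral>\<omega>. F (\<lambda>i. X (i + k) \<omega>) \<partial>M) = (\<integral>\<omega>. F (\<lambda>i. X i \<omega>) \<partial>M)"
    and integrable_shift: "integrable M (\<lambda>\<omega>. F (\<lambda>i. X (i + k) \<omega>)) \<longleftrightarrow> integrable M (\<lambda>\<omega>. F (\<lambda>i. X i \<omega>))"
proof -
  \<comment> \<open>The unshifted path is written with \<open>i + 0\<close>, so that
    \<open>path_measurable\<close> fits both sides before the zero is simplified away.\<close>
  have eq: "integral\<^sup>L (distr M (\<Pi>\<^sub>M i\<in>UNIV. N) (\<lambda>\<omega> i. X (i + k) \<omega>)) F =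
      integral\<^sup>L (distr M (\<Pi>\<^sub>M i\<in>UNIV. N) (\<lambda>\<omega> i. X (i + 0) \<omega>)) F"
    by (simp only: distr_shift)
  thus "(\<integral>\<omega>. F (\<lambda>i. X (i + k) \<omega>) \<partial>M) = (\<integral>\<omega>. F (\<lambda>i. X i \<omega>) \<partial>M)"
    by (subst (asm) (1 2) integral_distr) (simp_all add: path_measurable F del: add_0_right, simp)
  have eq: "integrable (distr M (\<Pi>\<^sub>M i\<in>UNIV. N) (\<lambda>\<omega> i. X (i + k) \<omega>)) F \<longleftrightarrow>
      integrable (distr M (\<Pi>\<^sub>M i\<in>UNIV. N) (\<lambda>\<omega> i. X (i + 0) \<omega>)) F"
    by (simp only: distr_shift)
  thus "integrable M (\<lambda>\<omega>. F (\<lambda>i. X (i + k) \<omega>)) \<longleftrightarrow> integrable M (\<lambda>\<omega>. F (\<lambda>i. X i \<omega>))"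
    by (subst (asm) (1 2) integrable_distr_eq) (simp_all add: path_measurable F del: add_0_right, simp)
qed

lemma
  fixes F :: "(int \<Rightarrow> 's) \<Rightarrow> real"
  assumes F [measurable]: "F \<in> borel_measurable (\<Pi>\<^sub>M i\<in>UNIV. N)"
  shows norm_L2_shift: "norm_L2 M (\<lambda>\<omega>. F (\<lambda>i. X (i + k) \<omega>)) = norm_L2 M (\<lambda>\<omega>. F (\<lambda>i. X i \<omega>))"
    and in_L2_shift: "in_L2 M (\<lambda>\<omega>. F (\<lambda>i. X (i + k) \<omega>)) \<longleftrightarrow> in_L2 M (\<lambda>\<omega>. F (\<lambda>i. X i \<omega>))"
proof -
  have F2: "(\<lambda>x. (F x)\<^sup>2) \<in> borel_measurable (\<Pi>\<^sub>M i\<in>UNIV. N)" by measurable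
  show "norm_L2 M (\<lambda>\<omega>. F (\<lambda>i. X (i + k) \<omega>)) = norm_L2 M (\<lambda>\<omega>. F (\<lambda>i. X i \<omega>))"
    unfolding norm_L2_def by (simp add: integral_shift[OF F2])
  have "(\<lambda>\<omega>. F (\<lambda>i. X (i + k) \<omega>)) \<in> borel_measurable M" for k
    by (rule measurable_compose[OF path_measurable F])
  from this[of k] this[of 0]
  show "in_L2 M (\<lambda>\<omega>. F (\<lambda>i. X (i + k) \<omega>)) \<longleftrightarrow> in_L2 M (\<lambda>\<omega>. F (\<lambda>i. X i \<omega>))"
    unfolding in_L2_def by (simp add: integrable_shift[OF F2])
qed

lemma
  fixes f :: "'s \<Rightarrow> real"
  assumes [measurable]: "f \<in> borel_measurable N"
  shows norm_L2_marginal: "norm_L2 M (\<lambda>\<omega>. f (X k \<omega>)) = norm_L2 M (\<lambda>\<omega>. f (X 0 \<omega>))"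
    and in_L2_marginal: "in_L2 M (\<lambda>\<omega>. f (X k \<omega>)) \<longleftrightarrow> in_L2 M (\<lambda>\<omega>. f (X 0 \<omega>))"
    and integrable_marginal: "integrable M (\<lambda>\<omega>. f (X k \<omega>)) \<longleftrightarrow> integrable M (\<lambda>\<omega>. f (X 0 \<omega>))"
proof -
  have F: "(\<lambda>x. f (x 0)) \<in> borel_measurable (\<Pi>\<^sub>M i\<in>(UNIV::int set). N)" by measurable
  show "norm_L2 M (\<lambda>\<omega>. f (X k \<omega>)) = norm_L2 M (\<lambda>\<omega>. f (X 0 \<omega>))"
    using norm_L2_shift[OF F, of k] by simp
  show "in_L2 M (\<lambda>\<omega>. f (X k \<omega>)) \<longleftrightarrow> in_L2 M (\<lambda>\<omega>. f (X 0 \<omega>))"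
    using in_L2_shift[OF F, of k] by simp
  show "integrable M (\<lambda>\<omega>. f (X k \<omega>)) \<longleftrightarrow> integrable M (\<lambda>\<omega>. f (X 0 \<omega>))"
    using integrable_shift[OF F, of k] by simp
qed

lemma in_L2_distr: "in_L2 (distr M N (X 0)) f \<longleftrightarrow> f \<in> borel_measurable N \<and> in_L2 M (\<lambda>\<omega>. f (X 0 \<omega>))"
  by (auto simp: in_L2_def integrable_distr_eq)

lemma norm_L2_distr:
  "f \<in> borel_measurable N \<Longrightarrow> norm_L2 (distr M N (X 0)) f = norm_L2 M (\<lambda>\<omega>. f (X 0 \<omega>))"
  by (simp add: norm_L2_def integral_distr)

section \<open>The past of a time and the sigma-algebra of a single state\<close>

lemma space_past [simp]: "space (past_alg M N X i) = space M"
  by (auto simp: past_alg_def space_measure_of_conv)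

lemma sets_past:
  "sets (past_alg M N X i) = sigma_sets (space M) (\<Union>j\<in>{..i}. {X j -` A \<inter> space M | A. A \<in> sets N})"
  unfolding past_alg_def by (rule sets_measure_of) auto

lemma X_past_measurable: "j \<le> i \<Longrightarrow> X j \<in> measurable (past_alg M N X i) N"
  by (rule measurableI) (auto simp: X_space sets_past intro!: sigma_sets.Basic)

lemma past_subalgebra: "subalgebra M (past_alg M N X i)"
  unfolding subalgebra_def sets_past
  by (auto intro!: sets.sigma_sets_subset)

lemma past_mono: "i \<le> j \<Longrightarrow> subalgebra (past_alg M N X j) (past_alg M N X i)"
  unfolding subalgebra_def sets_past space_past
  by (intro conjI refl sigma_sets_mono' UN_mono) auto

lemma space_gen_alg [simp]: "space (gen_alg M N Y) = space M"
  by (simp add: gen_alg_def)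

lemma X_gen_measurable: "X i \<in> measurable (gen_alg M N (X i)) N"
  unfolding gen_alg_def by (rule measurable_vimage_algebra1) (auto simp: X_space)

lemma sets_gen_alg: "sets (gen_alg M N (X i)) = {X i -` A \<inter> space M | A. A \<in> sets N}"
  unfolding gen_alg_def by (rule sets_vimage_algebra2) (auto simp: X_space)

lemma gen_subalgebra_past: "subalgebra (past_alg M N X i) (gen_alg M N (X i))"
  unfolding subalgebra_def sets_past sets_gen_alg by auto

lemma gen_subalgebra: "subalgebra M (gen_alg M N (X i))"
  unfolding subalgebra_def sets_gen_alg by auto

lemma sigma_finite_subalg: "subalgebra M F \<Longrightarrow> sigma_finite_subalgebra M F"
  by (intro finite_measure_subalgebra.axioms finite_measure_subalgebra_is_sigma_finite)
     (simp add: finite_measure_subalgebra_def finite_measure_subalgebra_axioms_def finite_measure_axioms)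

section \<open>One-step transitions under the kernel\<close>

lemma pair_law:
  assumes C [measurable]: "C \<in> sets N" and B [measurable]: "B \<in> sets N"
  shows "(\<integral>\<omega>. indicator C (X i \<omega>) * indicator B (X (i + 1) \<omega>) \<partial>M) =
    (\<integral>\<omega>. indicator C (X i \<omega>) * measure (Q (X i \<omega>)) B \<partial>M)"
proof -
  interpret G: sigma_finite_subalgebra M "gen_alg M N (X 0)"
    by (rule sigma_finite_subalg[OF gen_subalgebra])
  have [measurable]: "(\<lambda>x. measure (Q x) B) \<in> borel_measurable N"
    by measurable
  have [measurable]: "(\<lambda>\<omega>. indicator C (X 0 \<omega>) :: real) \<in> borel_measurable (gen_alg M N (X 0))"
    by (rule measurable_compose[OF X_gen_measurable]) simp
  have int: "integrable M (\<lambda>\<omega>. indicator C (X 0 \<omega>) * indicator B (X 1 \<omega>) :: real)"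
    by (rule integrable_const_bound[where B = 1]) (auto simp: indicator_def)
  \<comment> \<open>The kernel is tied to the times 0 and 1. Stationarity carries the joint law of
    two consecutive states there, and a second shift at the end returns to time i.\<close>
  have "(\<integral>\<omega>. indicator C (X i \<omega>) * indicator B (X (i + 1) \<omega>) \<partial>M) =
      (\<integral>\<omega>. indicator C (X 0 \<omega>) * indicator B (X 1 \<omega>) \<partial>M :: real)"
    using integral_shift[of "\<lambda>x. indicator C (x 0) * indicator B (x 1)" i] by (simp add: add.commute)
  also have "\<dots> = (\<integral>\<omega>. indicator C (X 0 \<omega>) *
      real_cond_exp M (gen_alg M N (X 0)) (\<lambda>\<omega>. indicator B (X 1 \<omega>)) \<omega> \<partial>M)"
    by (rule G.real_cond_exp_intg(2)[symmetric]) (use int in measurable)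
  also have "\<dots> = (\<integral>\<omega>. indicator C (X 0 \<omega>) * measure (Q (X 0 \<omega>)) B \<partial>M)"
  proof (rule integral_cong_AE)
    show "AE \<omega> in M. indicator C (X 0 \<omega>) * real_cond_exp M (gen_alg M N (X 0)) (\<lambda>\<omega>. indicator B (X 1 \<omega>)) \<omega> =
      indicator C (X 0 \<omega>) * measure (Q (X 0 \<omega>)) B"
      using kernel B unfolding regular_cond_distr_def by (auto elim: eventually_mono)
  qed measurable
  also have "\<dots> = (\<integral>\<omega>. indicator C (X i \<omega>) * measure (Q (X i \<omega>)) B \<partial>M)"
    using integral_shift[of "\<lambda>x. indicator C (x 0) * measure (Q (x 0)) B" i] by simp
  finally show ?thesis .
qed

text \<open>\<open>pair_law\<close> identifies the conditional probability given \<open>X i\<close>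
  alone, since the sets of that sigma-algebra are exactly the preimages under \<open>X i\<close>;
  the Markov property then exchanges it for the whole past.\<close>

lemma cond_prob_past:
  assumes B [measurable]: "B \<in> sets N"
  shows "AE \<omega> in M. real_cond_exp M (past_alg M N X i) (\<lambda>\<omega>. indicator B (X (i + 1) \<omega>)) \<omega> =
    measure (Q (X i \<omega>)) B"
proof -
  interpret G: sigma_finite_subalgebra M "gen_alg M N (X i)"
    by (rule sigma_finite_subalg[OF gen_subalgebra])
  have [measurable]: "(\<lambda>x. measure (Q x) B) \<in> borel_measurable N"
    by measurable
  have le1: "measure (Q (X i \<omega>)) B \<le> 1" if "\<omega> \<in> space M" for \<omega>
    using measurable_space[OF Q_prob X_space[OF that]] by (auto simp: space_prob_algebra prob_space.prob_le_1)
  have "AE \<omega> in M. real_cond_exp M (gen_alg M N (X i)) (\<lambda>\<omega>. indicator B (X (i + 1) \<omega>)) \<omega> =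
    measure (Q (X i \<omega>)) B"
  proof (rule G.real_cond_exp_charact)
    fix A assume "A \<in> sets (gen_alg M N (X i))"
    then obtain C where C: "C \<in> sets N" "A = X i -` C \<inter> space M" by (auto simp: sets_gen_alg)
    show "(\<integral>\<omega>\<in>A. indicator B (X (i + 1) \<omega>) \<partial>M) = (\<integral>\<omega>\<in>A. measure (Q (X i \<omega>)) B \<partial>M)"
    proof -
      have "(\<integral>\<omega>\<in>A. u \<omega> \<partial>M) = (\<integral>\<omega>. indicator C (X i \<omega>) * u \<omega> \<partial>M)" for u :: "'w \<Rightarrow> real"
        unfolding set_lebesgue_integral_def real_scaleR_def
        by (rule Bochner_Integration.integral_cong) (auto simp: C(2) indicator_def)
      thus ?thesis using pair_law[OF C(1) B, of i] by simp
    qed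
  next
    show "integrable M (\<lambda>\<omega>. indicator B (X (i + 1) \<omega>) :: real)"
      by (rule integrable_const_bound[where B = 1]) (auto simp: indicator_def)
    show "integrable M (\<lambda>\<omega>. measure (Q (X i \<omega>)) B)"
      by (rule integrable_const_bound[where B = 1]) (use le1 in auto)
    show "(\<lambda>\<omega>. measure (Q (X i \<omega>)) B) \<in> borel_measurable (gen_alg M N (X i))"
      by (rule measurable_compose[OF X_gen_measurable]) measurable
  qed
  moreover have "AE \<omega> in M. real_cond_exp M (past_alg M N X i) (\<lambda>\<omega>. indicator B (X (i + 1) \<omega>)) \<omega> =
      real_cond_exp M (gen_alg M N (X i)) (\<lambda>\<omega>. indicator B (X (i + 1) \<omega>)) \<omega>"
    using markov B by (simp add: markov_chain_def)
  ultimately show ?thesis by eventually_elim simp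
qed

text \<open>Instead of approximating f, two measures on the state space are compared: the law of
  \<open>X (i + 1)\<close> on the event A, and the law of \<open>X i\<close> on A followed by one
  step of Q. They agree on measurable sets by \<open>cond_prob_past\<close>, hence have equal
  integrals.\<close>

lemma nn_integral_transition:
  assumes A: "A \<in> sets (past_alg M N X i)" and f [measurable]: "f \<in> borel_measurable N"
  shows "(\<integral>\<^sup>+\<omega>. indicator A \<omega> * f (X (i + 1) \<omega>) \<partial>M) =
    (\<integral>\<^sup>+\<omega>. indicator A \<omega> * (\<integral>\<^sup>+y. f y \<partial>Q (X i \<omega>)) \<partial>M)"
proof -
  interpret F: sigma_finite_subalgebra M "past_alg M N X i"
    by (rule sigma_finite_subalg[OF past_subalgebra])
  have AM [measurable]: "A \<in> sets M" using A past_subalgebra by (auto simp: subalgebra_def)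
  define \<mu> where "\<mu> = distr (density M (indicator A)) N (X (i + 1))"
  define \<nu> where "\<nu> = distr (density M (indicator A)) N (X i) \<bind> Q"
  have N_ne: "space N \<noteq> {}" using X_space not_empty by blast
  have sets_\<nu>: "sets \<nu> = sets N"
    unfolding \<nu>_def by (rule sets_bind) (use N_ne sets_kernel[OF Q_subprob] in auto)
  have nn_eq: "(\<integral>\<^sup>+y. indicator B y \<partial>\<mu>) = (\<integral>\<^sup>+y. indicator B y \<partial>\<nu>)" if B [measurable]: "B \<in> sets N" for B
  proof -
    have [measurable]: "(\<lambda>x. measure (Q x) B) \<in> borel_measurable N" by measurable
    have emeas: "emeasure (Q (X i \<omega>)) B = ennreal (measure (Q (X i \<omega>)) B)"
      and le1: "measure (Q (X i \<omega>)) B \<le> 1" if "\<omega> \<in> space M" for \<omega>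
    proof -
      have "prob_space (Q (X i \<omega>))"
        using measurable_space[OF Q_prob X_space[OF that]] by (auto simp: space_prob_algebra)
      thus "emeasure (Q (X i \<omega>)) B = ennreal (measure (Q (X i \<omega>)) B)" "measure (Q (X i \<omega>)) B \<le> 1"
        by (auto intro: prob_space.prob_le_1 finite_measure.emeasure_eq_measure prob_space.finite_measure)
    qed
    have int1: "integrable M (\<lambda>\<omega>. indicator A \<omega> * indicator B (X (i + 1) \<omega>) :: real)"
      by (rule integrable_const_bound[where B = 1]) (auto simp: indicator_def)
    have int2: "integrable M (\<lambda>\<omega>. indicator A \<omega> * measure (Q (X i \<omega>)) B)"
      by (rule integrable_const_bound[where B = 1]) (use le1 in \<open>auto simp: indicator_def\<close>)
    have "(\<integral>\<^sup>+y. indicator B y \<partial>\<mu>) = (\<integral>\<^sup>+\<omega>. indicator A \<omega> * indicator B (X (i + 1) \<omega>) \<partial>M)"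
      unfolding \<mu>_def by (simp add: nn_integral_distr nn_integral_density del: nn_integral_indicator)
    \<comment> \<open>Conditional expectations are real-valued, so the computation passes to Bochner
      integrals of functions bounded by 1 and back again.\<close>
    also have "\<dots> = (\<integral>\<^sup>+\<omega>. ennreal (indicator A \<omega> * indicator B (X (i + 1) \<omega>)) \<partial>M)"
      by (intro nn_integral_cong) (auto simp: indicator_def)
    also have "\<dots> = ennreal (\<integral>\<omega>. indicator A \<omega> * indicator B (X (i + 1) \<omega>) \<partial>M)"
      by (rule nn_integral_eq_integral[OF int1]) (simp add: indicator_def)
    also have "(\<integral>\<omega>. indicator A \<omega> * indicator B (X (i + 1) \<omega>) \<partial>M) =
        (\<integral>\<omega>. indicator A \<omega> * real_cond_exp M (past_alg M N X i) (\<lambda>\<omega>. indicator B (X (i + 1) \<omega>)) \<omega> \<partial>M)"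
      by (rule F.real_cond_exp_intg(2)[symmetric]) (use int1 A in auto)
    also have "\<dots> = (\<integral>\<omega>. indicator A \<omega> * measure (Q (X i \<omega>)) B \<partial>M)"
      by (rule integral_cong_AE) (use cond_prob_past[OF B, of i] in \<open>auto elim: eventually_mono\<close>)
    also have "ennreal \<dots> = (\<integral>\<^sup>+\<omega>. ennreal (indicator A \<omega> * measure (Q (X i \<omega>)) B) \<partial>M)"
      by (rule nn_integral_eq_integral[OF int2, symmetric]) simp
    also have "\<dots> = (\<integral>\<^sup>+\<omega>. indicator A \<omega> * emeasure (Q (X i \<omega>)) B \<partial>M)"
      by (intro nn_integral_cong) (auto simp: emeas indicator_def)
    also have "\<dots> = (\<integral>\<^sup>+\<omega>. emeasure (Q (X i \<omega>)) B \<partial>density M (indicator A))"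
      by (subst nn_integral_density) auto
    also have "\<dots> = (\<integral>\<^sup>+x. emeasure (Q x) B \<partial>distr (density M (indicator A)) N (X i))"
      by (subst nn_integral_distr) auto
    also have "\<dots> = emeasure \<nu> B"
      unfolding \<nu>_def by (rule emeasure_bind[where N = N, symmetric]) (use N_ne in auto)
    also have "\<dots> = (\<integral>\<^sup>+y. indicator B y \<partial>\<nu>)"
      by (rule nn_integral_indicator[symmetric]) (simp add: sets_\<nu>)
    finally show ?thesis .
  qed
  have "\<mu> = \<nu>"
  proof (rule measure_eqI)
    show "sets \<mu> = sets \<nu>" by (simp add: \<mu>_def sets_\<nu>)
    fix B assume "B \<in> sets \<mu>"
    with nn_eq[of B] \<open>sets \<mu> = sets \<nu>\<close> show "emeasure \<mu> B = emeasure \<nu> B"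
      by (simp add: \<mu>_def)
  qed
  hence "(\<integral>\<^sup>+y. f y \<partial>\<mu>) = (\<integral>\<^sup>+y. f y \<partial>\<nu>)" by simp
  also have "(\<integral>\<^sup>+y. f y \<partial>\<mu>) = (\<integral>\<^sup>+\<omega>. indicator A \<omega> * f (X (i + 1) \<omega>) \<partial>M)"
    unfolding \<mu>_def by (simp add: nn_integral_distr nn_integral_density)
  also have "(\<integral>\<^sup>+y. f y \<partial>\<nu>) = (\<integral>\<^sup>+x. \<integral>\<^sup>+y. f y \<partial>Q x \<partial>distr (density M (indicator A)) N (X i))"
    unfolding \<nu>_def by (rule nn_integral_bind[where B = N]) auto
  also have "\<dots> = (\<integral>\<^sup>+\<omega>. indicator A \<omega> * (\<integral>\<^sup>+y. f y \<partial>Q (X i \<omega>)) \<partial>M)"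
    by (subst nn_integral_distr, simp, simp, subst nn_integral_density) auto
  finally show ?thesis .
qed

text \<open>The nonnegative integral \<open>p\<close> of f under Q is finite along
  \<open>X i\<close> almost surely, because its mean equals that of \<open>f (X (i + 1))\<close>.
  Off a null set it coincides with \<open>kernel_op Q f\<close>, which carries
  \<open>nn_integral_transition\<close> over to Bochner integrals.\<close>

lemma transition_nonneg:
  fixes f :: "'s \<Rightarrow> real"
  assumes f [measurable]: "f \<in> borel_measurable N" and f0: "\<And>x. f x \<ge> 0"
    and int: "integrable M (\<lambda>\<omega>. f (X (i + 1) \<omega>))"
  shows "AE \<omega> in M. integrable (Q (X i \<omega>)) f"
    and "AE \<omega> in M. real_cond_exp M (past_alg M N X i) (\<lambda>\<omega>. f (X (i + 1) \<omega>)) \<omega> = kernel_op Q f (X i \<omega>)"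
proof -
  interpret F: sigma_finite_subalgebra M "past_alg M N X i"
    by (rule sigma_finite_subalg[OF past_subalgebra])
  define p where "p = (\<lambda>x. \<integral>\<^sup>+y. ennreal (f y) \<partial>Q x)"
  have p [measurable]: "p \<in> borel_measurable N"
    unfolding p_def by (rule measurable_compose[OF Q_subprob nn_integral_measurable_subprob_algebra]) simp
  have fQ: "f \<in> borel_measurable (Q (X i \<omega>))" if "\<omega> \<in> space M" for \<omega>
    using f subprob_measurableD(2)[OF Q_subprob X_space[OF that]] by (simp cong: measurable_cong_sets)
  have tr: "(\<integral>\<^sup>+\<omega>. indicator A \<omega> * ennreal (f (X (i + 1) \<omega>)) \<partial>M) = (\<integral>\<^sup>+\<omega>. indicator A \<omega> * p (X i \<omega>) \<partial>M)"
    if "A \<in> sets (past_alg M N X i)" for A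
    using nn_integral_transition[OF that, of "\<lambda>x. ennreal (f x)"] by (simp add: p_def)
  have top: "space M \<in> sets (past_alg M N X i)"
    using sets.top[of "past_alg M N X i"] by simp
  have fin: "(\<integral>\<^sup>+\<omega>. p (X i \<omega>) \<partial>M) < \<infinity>"
  proof -
    have "(\<integral>\<^sup>+\<omega>. p (X i \<omega>) \<partial>M) = (\<integral>\<^sup>+\<omega>. indicator (space M) \<omega> * p (X i \<omega>) \<partial>M)"
      by (intro nn_integral_cong) simp
    also have "\<dots> = (\<integral>\<^sup>+\<omega>. indicator (space M) \<omega> * ennreal (f (X (i + 1) \<omega>)) \<partial>M)"
      by (rule tr[OF top, symmetric])
    also have "\<dots> = (\<integral>\<^sup>+\<omega>. ennreal (norm (f (X (i + 1) \<omega>))) \<partial>M)"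
      by (intro nn_integral_cong) (simp add: f0)
    also have "\<dots> < \<infinity>" using int by (simp add: integrable_iff_bounded)
    finally show ?thesis .
  qed
  have pfin: "AE \<omega> in M. p (X i \<omega>) \<noteq> \<infinity>"
    by (rule nn_integral_PInf_AE) (use fin in auto)
  show "AE \<omega> in M. integrable (Q (X i \<omega>)) f"
    using pfin AE_space
  proof eventually_elim
    case (elim \<omega>)
    show ?case
      unfolding integrable_iff_bounded using fQ[OF elim(2)] elim(1) by (simp add: p_def f0 less_top)
  qed
  \<comment> \<open>Where \<open>p\<close> is infinite both sides take the default value 0, so this
    holds at every point of the space; the converse reading in \<open>kpp\<close> needs
    finiteness.\<close>
  have kp: "kernel_op Q f (X i \<omega>) = enn2real (p (X i \<omega>))" if "\<omega> \<in> space M" for \<omega>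
    unfolding kernel_op_def p_def by (rule integral_eq_nn_integral[OF fQ[OF that]]) (simp add: f0)
  have kpp: "AE \<omega> in M. ennreal (kernel_op Q f (X i \<omega>)) = p (X i \<omega>)"
    using pfin AE_space by eventually_elim (simp add: kp less_top)
  have k0: "kernel_op Q f x \<ge> 0" for x
    unfolding kernel_op_def by (simp add: f0)
  have nn: "(\<integral>\<^sup>+\<omega>. ennreal (indicator A \<omega> * kernel_op Q f (X i \<omega>)) \<partial>M) =
      (\<integral>\<^sup>+\<omega>. ennreal (indicator A \<omega> * f (X (i + 1) \<omega>)) \<partial>M)" if "A \<in> sets (past_alg M N X i)" for A
  proof -
    have "(\<integral>\<^sup>+\<omega>. ennreal (indicator A \<omega> * kernel_op Q f (X i \<omega>)) \<partial>M) = (\<integral>\<^sup>+\<omega>. indicator A \<omega> * p (X i \<omega>) \<partial>M)"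
      by (rule nn_integral_cong_AE) (use kpp in \<open>auto elim!: eventually_mono simp: indicator_def\<close>)
    also have "\<dots> = (\<integral>\<^sup>+\<omega>. indicator A \<omega> * ennreal (f (X (i + 1) \<omega>)) \<partial>M)" by (rule tr[OF that, symmetric])
    also have "\<dots> = (\<integral>\<^sup>+\<omega>. ennreal (indicator A \<omega> * f (X (i + 1) \<omega>)) \<partial>M)"
      by (intro nn_integral_cong) (simp add: indicator_def)
    finally show ?thesis .
  qed
  have kint: "integrable M (\<lambda>\<omega>. kernel_op Q f (X i \<omega>))"
    unfolding integrable_iff_bounded
  proof
    have "(\<integral>\<^sup>+\<omega>. ennreal (norm (kernel_op Q f (X i \<omega>))) \<partial>M) = (\<integral>\<^sup>+\<omega>. p (X i \<omega>) \<partial>M)"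
      by (rule nn_integral_cong_AE) (use kpp in \<open>auto elim!: eventually_mono simp: k0\<close>)
    thus "(\<integral>\<^sup>+\<omega>. ennreal (norm (kernel_op Q f (X i \<omega>))) \<partial>M) < \<infinity>" using fin by simp
  qed measurable
  show "AE \<omega> in M. real_cond_exp M (past_alg M N X i) (\<lambda>\<omega>. f (X (i + 1) \<omega>)) \<omega> = kernel_op Q f (X i \<omega>)"
  proof (rule F.real_cond_exp_charact[OF _ int kint])
    fix A assume A: "A \<in> sets (past_alg M N X i)"
    have [measurable]: "A \<in> sets M" using A past_subalgebra by (auto simp: subalgebra_def)
    show "(\<integral>\<omega>\<in>A. f (X (i + 1) \<omega>) \<partial>M) = (\<integral>\<omega>\<in>A. kernel_op Q f (X i \<omega>) \<partial>M)"
      unfolding set_lebesgue_integral_def real_scaleR_def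
      by (subst (1 2) integral_eq_nn_integral) (simp_all add: f0 k0 nn[OF A])
  next
    show "(\<lambda>\<omega>. kernel_op Q f (X i \<omega>)) \<in> borel_measurable (past_alg M N X i)"
      by (rule measurable_compose[OF X_past_measurable kernel_op_measurable]) simp_all
  qed
qed

text \<open>Splits f into positive and negative parts. Subtracting their integrals under Q is
  legitimate where both parts are integrable, which \<open>transition_nonneg\<close> grants almost
  surely.\<close>

lemma cond_exp_transition:
  fixes f :: "'s \<Rightarrow> real"
  assumes f [measurable]: "f \<in> borel_measurable N"
    and int0: "integrable M (\<lambda>\<omega>. f (X 0 \<omega>))"
  shows "AE \<omega> in M. real_cond_exp M (past_alg M N X i) (\<lambda>\<omega>. f (X (i + 1) \<omega>)) \<omega> = kernel_op Q f (X i \<omega>)"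
proof -
  interpret F: sigma_finite_subalgebra M "past_alg M N X i"
    by (rule sigma_finite_subalg[OF past_subalgebra])
  have int: "integrable M (\<lambda>\<omega>. f (X (i + 1) \<omega>))"
    using int0 integrable_marginal[OF f, of "i + 1"] by simp
  define u where "u = (\<lambda>x. max (f x) 0)"
  define v where "v = (\<lambda>x. max (- f x) 0)"
  have [measurable]: "u \<in> borel_measurable N" "v \<in> borel_measurable N"
    unfolding u_def v_def by measurable
  have iu: "integrable M (\<lambda>\<omega>. u (X (i + 1) \<omega>))" and iv: "integrable M (\<lambda>\<omega>. v (X (i + 1) \<omega>))"
    unfolding u_def v_def using int by auto
  note U = transition_nonneg[of u, OF _ _ iu] and V = transition_nonneg[of v, OF _ _ iv]
  have u0: "u x \<ge> 0" "v x \<ge> 0" for x by (simp_all add: u_def v_def)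
  have fuv: "f = (\<lambda>x. u x - v x)" by (auto simp: u_def v_def)
  have k: "AE \<omega> in M. kernel_op Q f (X i \<omega>) = kernel_op Q u (X i \<omega>) - kernel_op Q v (X i \<omega>)"
    using U(1)[OF _ u0(1), simplified] V(1)[OF _ u0(2), simplified]
    by eventually_elim (subst fuv, simp add: kernel_op_def)
  have "AE \<omega> in M. real_cond_exp M (past_alg M N X i) (\<lambda>\<omega>. u (X (i + 1) \<omega>) - v (X (i + 1) \<omega>)) \<omega> =
      real_cond_exp M (past_alg M N X i) (\<lambda>\<omega>. u (X (i + 1) \<omega>)) \<omega> -
      real_cond_exp M (past_alg M N X i) (\<lambda>\<omega>. v (X (i + 1) \<omega>)) \<omega>"
    by (rule F.real_cond_exp_diff[OF iu iv])
  with U(2)[OF _ u0(1), simplified] V(2)[OF _ u0(2), simplified] k show "AE \<omega> in M. real_cond_exp M (past_alg M N X i) (\<lambda>\<omega>. f (X (i + 1) \<omega>)) \<omega> = kernel_op Q f (X i \<omega>)"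
    unfolding fun_cong[OF fuv, of "X (i + 1) _"] by eventually_elim simp
qed

section \<open>Functions in L2(pi), represented through \<open>X 0\<close>, and the operator Q on
  them\<close>

abbreviation "chain_L2 f \<equiv> f \<in> borel_measurable N \<and> in_L2 M (\<lambda>\<omega>. f (X 0 \<omega>))"

lemma chain_L2_X: "chain_L2 f \<Longrightarrow> in_L2 M (\<lambda>\<omega>. f (X i \<omega>))"
  using in_L2_marginal by blast

lemma chain_L2_integrable: "chain_L2 f \<Longrightarrow> integrable M (\<lambda>\<omega>. f (X i \<omega>))"
  by (rule in_L2_integrable[OF chain_L2_X])

text \<open>\<open>kernel_op Q f (X 0 \<omega>)\<close> is a version of E(f(X_1) | F_0) and inherits
  square integrability from conditional expectation.\<close>

lemma kernel_op_L2:
  assumes f: "chain_L2 f"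
  shows "chain_L2 (kernel_op Q f)"
proof
  have fm [measurable]: "f \<in> borel_measurable N" using f by simp
  show "kernel_op Q f \<in> borel_measurable N" by measurable
  interpret F: sigma_finite_subalgebra M "past_alg M N X 0"
    by (rule sigma_finite_subalg[OF past_subalgebra])
  have "in_L2 M (real_cond_exp M (past_alg M N X 0) (\<lambda>\<omega>. f (X (0 + 1) \<omega>)))"
    by (intro F.real_cond_exp_L2 chain_L2_X chain_L2_integrable f)
  thus "in_L2 M (\<lambda>\<omega>. kernel_op Q f (X 0 \<omega>))"
    by (rule in_L2_AE_cong)
       (use cond_exp_transition[OF fm chain_L2_integrable[OF f], of 0] in auto)
qed

lemma chain_L2_funpow: "chain_L2 f \<Longrightarrow> chain_L2 ((kernel_op Q ^^ k) f)"
  by (induction k) (simp_all only: funpow.simps id_apply comp_apply kernel_op_L2 conj_ac)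

lemma chain_L2_sum: "(\<And>j. j \<in> I \<Longrightarrow> chain_L2 (f j)) \<Longrightarrow> chain_L2 (\<lambda>x. \<Sum>j\<in>I. f j x)"
  by (intro conjI borel_measurable_sum in_L2_sum) auto

lemma chain_L2_cmult: "chain_L2 f \<Longrightarrow> chain_L2 (\<lambda>x. c * f x)"
  by (intro conjI in_L2_cmult borel_measurable_times) auto

lemma chain_L2_divide: "chain_L2 f \<Longrightarrow> chain_L2 (\<lambda>x. f x / c)"
  by (intro conjI in_L2_divide borel_measurable_divide) auto

lemma chain_L2_add: "chain_L2 u \<Longrightarrow> chain_L2 v \<Longrightarrow> chain_L2 (\<lambda>x. u x + v x)"
  by (intro conjI in_L2_add borel_measurable_add) auto

lemma chain_L2_diff: "chain_L2 u \<Longrightarrow> chain_L2 v \<Longrightarrow> chain_L2 (\<lambda>x. u x - v x)"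
  by (intro conjI in_L2_diff borel_measurable_diff) auto

text \<open>Conditional expectation does not increase the norm of f(X_1), and stationarity
  identifies that norm with the one at time 0.\<close>

lemma kernel_op_norm:
  assumes f: "chain_L2 f"
  shows "norm_L2 M (\<lambda>\<omega>. kernel_op Q f (X 0 \<omega>)) \<le> norm_L2 M (\<lambda>\<omega>. f (X 0 \<omega>))"
proof -
  have fm [measurable]: "f \<in> borel_measurable N" using f by simp
  interpret F: sigma_finite_subalgebra M "past_alg M N X 0"
    by (rule sigma_finite_subalg[OF past_subalgebra])
  have "norm_L2 M (\<lambda>\<omega>. kernel_op Q f (X 0 \<omega>)) =
      norm_L2 M (real_cond_exp M (past_alg M N X 0) (\<lambda>\<omega>. f (X (0 + 1) \<omega>)))"
    by (rule norm_L2_AE_cong)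
       (use cond_exp_transition[OF fm chain_L2_integrable[OF f], of 0] in \<open>auto elim: eventually_mono\<close>)
  also have "\<dots> \<le> norm_L2 M (\<lambda>\<omega>. f (X (0 + 1) \<omega>))"
    by (intro F.real_cond_exp_L2 chain_L2_X chain_L2_integrable f)
  also have "\<dots> = norm_L2 M (\<lambda>\<omega>. f (X 0 \<omega>))" by (rule norm_L2_marginal[OF fm])
  finally show ?thesis .
qed

text \<open>Tower property: conditioning first on the past of i + 1 invokes the induction hypothesis
  at that later time, after which one transition remains. Hence i is generalised in the
  induction.\<close>

lemma cond_exp_funpow:
  assumes f: "chain_L2 f"
  shows "AE \<omega> in M. real_cond_exp M (past_alg M N X i) (\<lambda>\<omega>. f (X (i + int k) \<omega>)) \<omega> =
    (kernel_op Q ^^ k) f (X i \<omega>)"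
proof (induction k arbitrary: i)
  case 0
  interpret F: sigma_finite_subalgebra M "past_alg M N X i"
    by (rule sigma_finite_subalg[OF past_subalgebra])
  show ?case
    using F.real_cond_exp_F_meas[OF chain_L2_integrable[OF f]
      measurable_compose[OF X_past_measurable[OF order_refl] conjunct1[OF f]]] by simp
next
  case (Suc k)
  interpret F: sigma_finite_subalgebra M "past_alg M N X i"
    by (rule sigma_finite_subalg[OF past_subalgebra])
  note q = chain_L2_funpow[OF f, of k]
  have qm [measurable]: "(kernel_op Q ^^ k) f \<in> borel_measurable N" using q by simp
  have "AE \<omega> in M. real_cond_exp M (past_alg M N X i)
      (real_cond_exp M (past_alg M N X (i + 1)) (\<lambda>\<omega>. f (X (i + int (Suc k)) \<omega>))) \<omega> =
      real_cond_exp M (past_alg M N X i) (\<lambda>\<omega>. f (X (i + int (Suc k)) \<omega>)) \<omega>"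
    by (intro F.real_cond_exp_nested_subalg past_subalgebra past_mono chain_L2_integrable f) simp
  moreover have "AE \<omega> in M. real_cond_exp M (past_alg M N X i)
      (real_cond_exp M (past_alg M N X (i + 1)) (\<lambda>\<omega>. f (X (i + int (Suc k)) \<omega>))) \<omega> =
      real_cond_exp M (past_alg M N X i) (\<lambda>\<omega>. (kernel_op Q ^^ k) f (X (i + 1) \<omega>)) \<omega>"
    by (rule F.real_cond_exp_cong) (use Suc.IH[of "i + 1"] in \<open>auto simp: add.assoc\<close>)
  moreover have "AE \<omega> in M. real_cond_exp M (past_alg M N X i) (\<lambda>\<omega>. (kernel_op Q ^^ k) f (X (i + 1) \<omega>)) \<omega> =
      kernel_op Q ((kernel_op Q ^^ k) f) (X i \<omega>)"
    by (rule cond_exp_transition[OF qm chain_L2_integrable[OF q]])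
  ultimately show ?case by eventually_elim simp
qed

text \<open>Additivity can fail at states where a summand is not integrable under Q, since the
  Bochner integral then defaults to 0. It is therefore read off almost surely from additivity of
  conditional expectation; scaling, by contrast, is exact at every state.\<close>

lemma kernel_op_add:
  assumes u: "chain_L2 u" and v: "chain_L2 v"
  shows "AE \<omega> in M. kernel_op Q (\<lambda>x. u x + v x) (X i \<omega>) = kernel_op Q u (X i \<omega>) + kernel_op Q v (X i \<omega>)"
proof -
  interpret F: sigma_finite_subalgebra M "past_alg M N X i"
    by (rule sigma_finite_subalg[OF past_subalgebra])
  have uv: "chain_L2 (\<lambda>x. u x + v x)" using u v by auto
  have "AE \<omega> in M. real_cond_exp M (past_alg M N X i) (\<lambda>\<omega>. u (X (i + 1) \<omega>) + v (X (i + 1) \<omega>)) \<omega> =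
      real_cond_exp M (past_alg M N X i) (\<lambda>\<omega>. u (X (i + 1) \<omega>)) \<omega> +
      real_cond_exp M (past_alg M N X i) (\<lambda>\<omega>. v (X (i + 1) \<omega>)) \<omega>"
    by (intro F.real_cond_exp_add chain_L2_integrable u v)
  with cond_exp_transition[OF conjunct1[OF u] chain_L2_integrable[OF u], of i]
    cond_exp_transition[OF conjunct1[OF v] chain_L2_integrable[OF v], of i]
    cond_exp_transition[OF conjunct1[OF uv] chain_L2_integrable[OF uv], of i]
  show ?thesis by eventually_elim simp
qed

lemma kernel_op_cmult: "kernel_op Q (\<lambda>x. c * f x) = (\<lambda>x. c * kernel_op Q f x)"
  by (simp add: kernel_op_def fun_eq_iff)

lemma kernel_op_sum:
  assumes "\<And>j. j \<in> I \<Longrightarrow> chain_L2 (f j)"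
  shows "AE \<omega> in M. kernel_op Q (\<lambda>x. \<Sum>j\<in>I. f j x) (X i \<omega>) = (\<Sum>j\<in>I. kernel_op Q (f j) (X i \<omega>))"
  using assms
proof (induction I rule: infinite_finite_induct)
  case (insert j I)
  have "AE \<omega> in M. kernel_op Q (\<lambda>x. f j x + (\<Sum>j\<in>I. f j x)) (X i \<omega>) =
      kernel_op Q (f j) (X i \<omega>) + kernel_op Q (\<lambda>x. \<Sum>j\<in>I. f j x) (X i \<omega>)"
    by (intro kernel_op_add chain_L2_sum insert.prems) auto
  moreover have "AE \<omega> in M. kernel_op Q (\<lambda>x. \<Sum>j\<in>I. f j x) (X i \<omega>) = (\<Sum>j\<in>I. kernel_op Q (f j) (X i \<omega>))"
    by (intro insert.IH insert.prems) simp
  ultimately show ?case by eventually_elim (use insert.hyps in simp)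
qed (simp_all add: kernel_op_def)

section \<open>Martingale differences along the chain\<close>

lemma martingale_differences_past:
  assumes "martingale_differences M (past_alg M N X) D" "1 \<le> j" "int j \<le> i"
  shows "D j \<in> borel_measurable (past_alg M N X i)"
  by (rule measurable_from_subalg[OF past_mono[OF assms(3)]])
     (use assms in \<open>simp add: martingale_differences_def\<close>)

lemma martingale_differences_integrable:
  "martingale_differences M (past_alg M N X) D \<Longrightarrow> 1 \<le> j \<Longrightarrow> integrable M (D j)"
  by (simp add: martingale_differences_def)

text \<open>Each new difference vanishes when projected on its immediate past, hence on F_0 by the
  tower property. The argument stays at the level of integrability, so it covers entries not known
  to be square integrable.\<close>

lemma martingale_cond_exp_0:
  assumes D: "martingale_differences M (past_alg M N X) D"
  shows "AE \<omega> in M. real_cond_exp M (past_alg M N X 0) (\<lambda>\<omega>. \<Sum>j=1..n. D j \<omega>) \<omega> = 0"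
proof (induction n)
  case 0
  interpret F: sigma_finite_subalgebra M "past_alg M N X 0"
    by (rule sigma_finite_subalg[OF past_subalgebra])
  show ?case using F.real_cond_exp_F_meas[of "\<lambda>_. 0"] by simp
next
  case (Suc n)
  interpret F: sigma_finite_subalgebra M "past_alg M N X 0"
    by (rule sigma_finite_subalg[OF past_subalgebra])
  have int: "integrable M (D (Suc n))" by (rule martingale_differences_integrable[OF D]) simp
  have z: "AE \<omega> in M. real_cond_exp M (past_alg M N X (int n)) (D (Suc n)) \<omega> = 0"
    using D unfolding martingale_differences_def by (auto dest!: spec[of _ "Suc n"])
  have "AE \<omega> in M. real_cond_exp M (past_alg M N X 0) (real_cond_exp M (past_alg M N X (int n)) (D (Suc n))) \<omega> =
      real_cond_exp M (past_alg M N X 0) (D (Suc n)) \<omega>"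
    by (intro F.real_cond_exp_nested_subalg past_subalgebra past_mono int) simp
  moreover have "AE \<omega> in M. real_cond_exp M (past_alg M N X 0) (real_cond_exp M (past_alg M N X (int n)) (D (Suc n))) \<omega> =
      real_cond_exp M (past_alg M N X 0) (\<lambda>_. 0) \<omega>"
    by (rule F.real_cond_exp_cong[OF z]) auto
  moreover have "AE \<omega> in M. real_cond_exp M (past_alg M N X 0) (\<lambda>_. 0) \<omega> = 0"
    by (rule F.real_cond_exp_F_meas) auto
  moreover have "AE \<omega> in M. real_cond_exp M (past_alg M N X 0) (\<lambda>\<omega>. (\<Sum>j=1..n. D j \<omega>) + D (Suc n) \<omega>) \<omega> =
      real_cond_exp M (past_alg M N X 0) (\<lambda>\<omega>. \<Sum>j=1..n. D j \<omega>) \<omega> + real_cond_exp M (past_alg M N X 0) (D (Suc n)) \<omega>"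
    by (intro F.real_cond_exp_add int Bochner_Integration.integrable_sum martingale_differences_integrable[OF D]) simp
  ultimately show ?case using Suc.IH by eventually_elim simp
qed

text \<open>In the induction step the partial sum is measurable with respect to F_n, so the cross
  term may be computed with the conditional expectation of the next difference, which is 0.\<close>

lemma martingale_orthogonality:
  assumes D: "martingale_differences M (past_alg M N X) D"
    and L2: "\<And>j. j \<in> {1..n} \<Longrightarrow> in_L2 M (D j)"
  shows "(\<integral>\<omega>. (\<Sum>j=1..n. D j \<omega>)\<^sup>2 \<partial>M) = (\<Sum>j=1..n. \<integral>\<omega>. (D j \<omega>)\<^sup>2 \<partial>M)"
  using L2
proof (induction n)
  case (Suc n)
  interpret F: sigma_finite_subalgebra M "past_alg M N X (int n)"
    by (rule sigma_finite_subalg[OF past_subalgebra])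
  have A: "in_L2 M (\<lambda>\<omega>. \<Sum>j=1..n. D j \<omega>)" and B: "in_L2 M (D (Suc n))"
    by (intro in_L2_sum Suc.prems; simp)+
  have meas: "(\<lambda>\<omega>. \<Sum>j=1..n. D j \<omega>) \<in> borel_measurable (past_alg M N X (int n))"
    by (intro borel_measurable_sum martingale_differences_past[OF D]) auto
  have z: "AE \<omega> in M. real_cond_exp M (past_alg M N X (int n)) (D (Suc n)) \<omega> = 0"
    using D unfolding martingale_differences_def by (auto dest!: spec[of _ "Suc n"])
  have "(\<integral>\<omega>. (\<Sum>j=1..n. D j \<omega>) * D (Suc n) \<omega> \<partial>M) =
      (\<integral>\<omega>. (\<Sum>j=1..n. D j \<omega>) * real_cond_exp M (past_alg M N X (int n)) (D (Suc n)) \<omega> \<partial>M)"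
    by (rule F.real_cond_exp_intg(2)[symmetric]) (use in_L2_integrable_mult[OF A B] meas B in \<open>auto simp: in_L2_def\<close>)
  also have "\<dots> = (\<integral>\<omega>. 0 \<partial>M)"
    by (rule integral_cong_AE) (use z A in \<open>auto simp: in_L2_def\<close>)
  finally have "(\<integral>\<omega>. (\<Sum>j=1..n. D j \<omega>) * D (Suc n) \<omega> \<partial>M) = 0" by simp
  thus ?case using in_L2_square_add[OF A B] Suc by simp
qed simp

section \<open>Martingale differences generated by a function on the state space\<close>

definition poisson_difference :: "('s \<Rightarrow> real) \<Rightarrow> nat \<Rightarrow> 'w \<Rightarrow> real" where
  "poisson_difference h j \<omega> = h (X (int j) \<omega>) - kernel_op Q h (X (int j - 1) \<omega>)"

lemma poisson_difference_L2: "chain_L2 h \<Longrightarrow> in_L2 M (poisson_difference h j)"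
  unfolding poisson_difference_def[abs_def] by (intro in_L2_diff chain_L2_X kernel_op_L2)

text \<open>The subtracted term is E(h(X_j) | F_{j-1}). Times are integers, so for j = 1 it refers
  to X_0.\<close>

lemma poisson_difference_martingale:
  assumes h: "chain_L2 h"
  shows "martingale_differences M (past_alg M N X) (poisson_difference h)"
  unfolding martingale_differences_def
proof (intro allI impI conjI)
  fix j :: nat
  have hm [measurable]: "h \<in> borel_measurable N" using h by simp
  interpret F: sigma_finite_subalgebra M "past_alg M N X (int j - 1)"
    by (rule sigma_finite_subalg[OF past_subalgebra])
  have [measurable]: "X (int j) \<in> measurable (past_alg M N X (int j)) N"
      "X (int j - 1) \<in> measurable (past_alg M N X (int j)) N"
      "X (int j - 1) \<in> measurable (past_alg M N X (int j - 1)) N"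
    by (simp_all add: X_past_measurable)
  show "poisson_difference h j \<in> borel_measurable (past_alg M N X (int j))"
    unfolding poisson_difference_def[abs_def] by measurable
  show "integrable M (poisson_difference h j)"
    by (rule in_L2_integrable[OF poisson_difference_L2[OF h]])
  have "AE \<omega> in M. real_cond_exp M (past_alg M N X (int j - 1))
      (\<lambda>\<omega>. h (X (int j) \<omega>) - kernel_op Q h (X (int j - 1) \<omega>)) \<omega> =
      real_cond_exp M (past_alg M N X (int j - 1)) (\<lambda>\<omega>. h (X (int j) \<omega>)) \<omega> -
      real_cond_exp M (past_alg M N X (int j - 1)) (\<lambda>\<omega>. kernel_op Q h (X (int j - 1) \<omega>)) \<omega>"
    by (intro F.real_cond_exp_diff chain_L2_integrable kernel_op_L2 h)
  moreover have "AE \<omega> in M. real_cond_exp M (past_alg M N X (int j - 1))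
      (\<lambda>\<omega>. kernel_op Q h (X (int j - 1) \<omega>)) \<omega> = kernel_op Q h (X (int j - 1) \<omega>)"
    by (intro F.real_cond_exp_F_meas chain_L2_integrable kernel_op_L2 h) measurable
  moreover note cond_exp_transition[OF hm chain_L2_integrable[OF h], of "int j - 1"]
  ultimately show "AE \<omega> in M. real_cond_exp M (past_alg M N X (int j - 1)) (poisson_difference h j) \<omega> = 0"
    unfolding poisson_difference_def[abs_def] by eventually_elim simp
qed

text \<open>The sequence is the image of the two-sided path under one measurable map
  \<open>T\<close>, and shifting its index amounts to applying \<open>T\<close> to the shifted path,
  whose law is unchanged.\<close>

lemma poisson_difference_stationary:
  assumes [measurable]: "h \<in> borel_measurable N"
  shows "stationary_process M borel {1..} (poisson_difference h)"
  unfolding stationary_process_def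
proof (intro conjI ballI allI impI)
  show "poisson_difference h j \<in> borel_measurable M" for j
    unfolding poisson_difference_def[abs_def] by measurable
  fix k :: nat
  define T where "T = (\<lambda>x :: int \<Rightarrow> 's. \<lambda>j\<in>{1::nat..}. h (x (int j)) - kernel_op Q h (x (int j - 1)))"
  have T [measurable]: "T \<in> measurable (\<Pi>\<^sub>M i\<in>UNIV. N) (\<Pi>\<^sub>M j\<in>{1..}. borel)"
    unfolding T_def by (rule measurable_restrict) measurable
  have eq: "distr M (\<Pi>\<^sub>M j\<in>{1..}. borel) (\<lambda>\<omega>. \<lambda>j\<in>{1..}. poisson_difference h (j + k) \<omega>) =
      distr (distr M (\<Pi>\<^sub>M i\<in>UNIV. N) (\<lambda>\<omega> i. X (i + int k) \<omega>)) (\<Pi>\<^sub>M j\<in>{1..}. borel) T" for k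
    by (subst distr_distr[OF T path_measurable])
       (auto simp: T_def poisson_difference_def comp_def fun_eq_iff algebra_simps intro!: distr_cong)
  show "distr M (\<Pi>\<^sub>M j\<in>{1..}. borel) (\<lambda>\<omega>. \<lambda>j\<in>{1..}. poisson_difference h (j + k) \<omega>) =
      distr M (\<Pi>\<^sub>M j\<in>{1..}. borel) (\<lambda>\<omega>. \<lambda>j\<in>{1..}. poisson_difference h j \<omega>)"
    using eq[of k] eq[of 0] by (simp add: distr_shift)
qed

lemma stationary_second_moment:
  fixes D :: "nat \<Rightarrow> 'w \<Rightarrow> real"
  assumes D: "stationary_process M borel {1::nat..} D" and j: "j \<ge> 1"
  shows "(\<integral>\<omega>. (D j \<omega>)\<^sup>2 \<partial>M) = (\<integral>\<omega>. (D 1 \<omega>)\<^sup>2 \<partial>M)"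
proof -
  have m: "D i \<in> borel_measurable M" if "i \<ge> 1" for i using D that by (simp add: stationary_process_def)
  have F: "(\<lambda>x :: nat \<Rightarrow> real. (x 1)\<^sup>2) \<in> borel_measurable (\<Pi>\<^sub>M i\<in>{1..}. borel)"
    by measurable
  have path: "(\<lambda>\<omega>. \<lambda>i\<in>{1..}. D (i + k) \<omega>) \<in> measurable M (\<Pi>\<^sub>M i\<in>{1..}. borel)" for k
    by (rule measurable_restrict) (auto intro: m)
  have eq: "integral\<^sup>L (distr M (\<Pi>\<^sub>M i\<in>{1..}. borel) (\<lambda>\<omega>. \<lambda>i\<in>{1..}. D (i + k) \<omega>)) (\<lambda>x. (x 1)\<^sup>2) =
      (\<integral>\<omega>. (D (1 + k) \<omega>)\<^sup>2 \<partial>M)" for k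
    by (subst integral_distr[OF path F]) simp
  \<comment> \<open>The shift by j - 1 moves the entry with index j to coordinate 1, the coordinate
    that \<open>eq\<close> evaluates.\<close>
  have "distr M (\<Pi>\<^sub>M i\<in>{1..}. borel) (\<lambda>\<omega>. \<lambda>i\<in>{1..}. D (i + (j - 1)) \<omega>) =
      distr M (\<Pi>\<^sub>M i\<in>{1..}. borel) (\<lambda>\<omega>. \<lambda>i\<in>{1..}. D (i + 0) \<omega>)"
    using D by (simp add: stationary_process_def)
  with eq[of "j - 1"] eq[of 0] j show ?thesis by simp
qed

end

section \<open>Sums along the chain\<close>

locale additive_functional = stationary_chain M N X Q
  for M :: "'w measure" and N :: "'s measure" and X :: "int \<Rightarrow> 'w \<Rightarrow> 's" and Q :: "'s \<Rightarrow> 's measure" +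
  fixes g :: "'s \<Rightarrow> real"
  assumes g_measurable [measurable]: "g \<in> borel_measurable N"
    and g_sq: "integrable M (\<lambda>\<omega>. (g (X 0 \<omega>))\<^sup>2)"
begin

section \<open>Partial sums, blocks and their conditional means\<close>

lemma g_L2: "chain_L2 g"
  using g_sq by (auto simp: in_L2_def)

abbreviation "s n \<equiv> norm_L2 M (psum X g n)"

text \<open>The function w_k of the overview: a version of E(S_k | X_0 = x), as
  \<open>cond_exp_psum\<close> confirms. \<open>cond_norm\<close> is its norm in L2(pi).\<close>

definition cond_mean :: "nat \<Rightarrow> 's \<Rightarrow> real" where
  "cond_mean k x = (\<Sum>j=1..k. (kernel_op Q ^^ j) g x)"

definition cond_norm :: "nat \<Rightarrow> real" where
  "cond_norm k = norm_L2 M (\<lambda>\<omega>. cond_mean k (X 0 \<omega>))"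

lemma cond_norm_nonneg [simp]: "cond_norm k \<ge> 0"
  by (simp add: cond_norm_def)

lemma cond_mean_L2: "chain_L2 (cond_mean k)"
  unfolding cond_mean_def[abs_def] by (intro chain_L2_sum chain_L2_funpow g_L2)

lemma psum_L2: "in_L2 M (psum X g n)"
  unfolding psum_def[abs_def] by (intro in_L2_sum chain_L2_X g_L2)

lemma psum_past_measurable: "psum X g n \<in> borel_measurable (past_alg M N X (int n))"
  unfolding psum_def[abs_def]
  by (intro borel_measurable_sum measurable_compose[OF X_past_measurable g_measurable]) auto

lemma psum_add: "psum X g (n + m) \<omega> = psum X g n \<omega> + (\<Sum>j=1..m. g (X (int n + int j) \<omega>))"
  by (induction m) (simp_all add: psum_def ac_simps)

lemma block_L2: "in_L2 M (\<lambda>\<omega>. \<Sum>j=1..m. g (X (i + int j) \<omega>))"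
  by (intro in_L2_sum chain_L2_X g_L2)

lemma block_norm: "norm_L2 M (\<lambda>\<omega>. \<Sum>j=1..m. g (X (i + int j) \<omega>)) = s m"
proof -
  have F: "(\<lambda>x. \<Sum>j=1..m. g (x (int j))) \<in> borel_measurable (\<Pi>\<^sub>M i\<in>UNIV. N)" by measurable
  show ?thesis using norm_L2_shift[OF F, of i] by (simp add: psum_def[abs_def] add.commute)
qed

lemma cond_exp_block:
  "AE \<omega> in M. real_cond_exp M (past_alg M N X i) (\<lambda>\<omega>. \<Sum>j=1..m. g (X (i + int j) \<omega>)) \<omega> = cond_mean m (X i \<omega>)"
proof -
  interpret F: sigma_finite_subalgebra M "past_alg M N X i"
    by (rule sigma_finite_subalg[OF past_subalgebra])
  have "AE \<omega> in M. real_cond_exp M (past_alg M N X i) (\<lambda>\<omega>. \<Sum>j=1..m. g (X (i + int j) \<omega>)) \<omega> =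
      (\<Sum>j=1..m. real_cond_exp M (past_alg M N X i) (\<lambda>\<omega>. g (X (i + int j) \<omega>)) \<omega>)"
    by (intro F.real_cond_exp_sum chain_L2_integrable g_L2)
  moreover have "AE \<omega> in M. \<forall>j. real_cond_exp M (past_alg M N X i) (\<lambda>\<omega>. g (X (i + int j) \<omega>)) \<omega> =
      (kernel_op Q ^^ j) g (X i \<omega>)"
    by (simp only: AE_all_countable cond_exp_funpow[OF g_L2] simp_thms)
  ultimately show ?thesis by eventually_elim (simp add: cond_mean_def)
qed

lemma cond_exp_psum:
  "AE \<omega> in M. real_cond_exp M (past_alg M N X 0) (psum X g n) \<omega> = cond_mean n (X 0 \<omega>)"
  using cond_exp_block[of 0 n] by (simp add: psum_def[abs_def])

text \<open>Conditioning on X_0 factors through conditioning on the whole past of time 0, and that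
  first step already produces a function of X_0.\<close>

lemma norm_cond_psum: "norm_L2 M (cond_psum M N X g n) = cond_norm n"
proof -
  let ?F = "past_alg M N X 0" and ?G = "gen_alg M N (X 0)"
  interpret G: sigma_finite_subalgebra M ?G by (rule sigma_finite_subalg[OF gen_subalgebra])
  have [measurable]: "cond_mean n \<in> borel_measurable N" using cond_mean_L2 by simp
  have "AE \<omega> in M. real_cond_exp M ?G (real_cond_exp M ?F (psum X g n)) \<omega> = real_cond_exp M ?G (psum X g n) \<omega>"
    by (intro G.real_cond_exp_nested_subalg past_subalgebra gen_subalgebra_past in_L2_integrable psum_L2)
  moreover have "AE \<omega> in M. real_cond_exp M ?G (real_cond_exp M ?F (psum X g n)) \<omega> =
      real_cond_exp M ?G (\<lambda>\<omega>. cond_mean n (X 0 \<omega>)) \<omega>"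
    by (rule G.real_cond_exp_cong[OF cond_exp_psum]) measurable
  moreover have "AE \<omega> in M. real_cond_exp M ?G (\<lambda>\<omega>. cond_mean n (X 0 \<omega>)) \<omega> = cond_mean n (X 0 \<omega>)"
    by (intro G.real_cond_exp_F_meas chain_L2_integrable cond_mean_L2 measurable_compose[OF X_gen_measurable]) measurable
  ultimately have "AE \<omega> in M. cond_psum M N X g n \<omega> = cond_mean n (X 0 \<omega>)"
    unfolding cond_psum_def by eventually_elim simp
  thus ?thesis unfolding cond_norm_def by (rule norm_L2_AE_cong) (auto simp: cond_psum_def)
qed

lemma second_moment_almost_additive:
  "\<bar>(s (n + m))\<^sup>2 - (s n)\<^sup>2 - (s m)\<^sup>2\<bar> \<le> 2 * s n * cond_norm m"
proof -
  interpret F: sigma_finite_subalgebra M "past_alg M N X (int n)"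
    by (rule sigma_finite_subalg[OF past_subalgebra])
  define T where "T = (\<lambda>\<omega>. \<Sum>j=1..m. g (X (int n + int j) \<omega>))"
  have T: "in_L2 M T" and Tn: "norm_L2 M T = s m" unfolding T_def by (rule block_L2, rule block_norm)
  have [measurable]: "cond_mean m \<in> borel_measurable N" using cond_mean_L2 by simp
  have [measurable]: "psum X g n \<in> borel_measurable M" using psum_L2 by (simp add: in_L2_def)
  have "psum X g (n + m) = (\<lambda>\<omega>. psum X g n \<omega> + T \<omega>)" by (simp add: fun_eq_iff psum_add T_def)
  hence "(s (n + m))\<^sup>2 = (s n)\<^sup>2 + (s m)\<^sup>2 + 2 * (\<integral>\<omega>. psum X g n \<omega> * T \<omega> \<partial>M)"
    using in_L2_square_add[OF psum_L2 T] by (simp add: norm_L2_sq flip: Tn)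
  \<comment> \<open>The first block is measurable with respect to F_n, so the second may be replaced
    by its conditional expectation, a function of X_n to which Cauchy-Schwarz and stationarity
    apply.\<close>
  moreover have "(\<integral>\<omega>. psum X g n \<omega> * T \<omega> \<partial>M) =
      (\<integral>\<omega>. psum X g n \<omega> * real_cond_exp M (past_alg M N X (int n)) T \<omega> \<partial>M)"
    by (rule F.real_cond_exp_intg(2)[symmetric])
       (use in_L2_integrable_mult[OF psum_L2 T] psum_past_measurable T in \<open>auto simp: in_L2_def\<close>)
  moreover have "\<dots> = (\<integral>\<omega>. psum X g n \<omega> * cond_mean m (X (int n) \<omega>) \<partial>M)"
    by (rule integral_cong_AE)
       (use cond_exp_block[of "int n" m] in \<open>auto simp: T_def elim: eventually_mono\<close>)
  moreover have "\<bar>\<integral>\<omega>. psum X g n \<omega> * cond_mean m (X (int n) \<omega>) \<partial>M\<bar> \<le>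
      s n * norm_L2 M (\<lambda>\<omega>. cond_mean m (X (int n) \<omega>))"
    by (intro in_L2_Cauchy_Schwarz psum_L2 chain_L2_X cond_mean_L2)
  moreover have "norm_L2 M (\<lambda>\<omega>. cond_mean m (X (int n) \<omega>)) = cond_norm m"
    unfolding cond_norm_def by (rule norm_L2_marginal) measurable
  ultimately show ?thesis by simp
qed

text \<open>The Cesaro mean of the first n partial sums of the Neumann series g + Q g + Q^2 g + ...,
  the formal inverse of I - Q applied to g. For n = 0 the division convention leaves g.\<close>

definition poisson_sol :: "nat \<Rightarrow> 's \<Rightarrow> real" where
  "poisson_sol n x = g x + (\<Sum>k=1..<n. cond_mean k x) / real n"

lemma poisson_sol_L2: "chain_L2 (poisson_sol n)"
  unfolding poisson_sol_def[abs_def]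
  by (intro chain_L2_add chain_L2_divide chain_L2_sum g_L2 cond_mean_L2)

lemma kernel_op_cond_mean:
  "AE \<omega> in M. kernel_op Q (cond_mean k) (X i \<omega>) = cond_mean (Suc k) (X i \<omega>) - cond_mean 1 (X i \<omega>)"
  using kernel_op_sum[of "{1..k}" "\<lambda>j. (kernel_op Q ^^ j) g" i, OF chain_L2_funpow[OF g_L2]]
proof eventually_elim
  case (elim \<omega>)
  have "cond_mean (Suc k) x = cond_mean 1 x + (\<Sum>j=1..k. kernel_op Q ((kernel_op Q ^^ j) g) x)" for x
    by (induction k) (simp_all add: cond_mean_def)
  with elim show ?case by (simp add: cond_mean_def[abs_def])
qed

text \<open>Q raises each index by one and subtracts w_1, n - 1 times in all. Together with Q g =
  w_1 this leaves w_1/n, precisely the missing first term of the full average.\<close>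

lemma kernel_op_poisson_sol:
  assumes n: "n \<ge> 1"
  shows "AE \<omega> in M. kernel_op Q (poisson_sol n) (X i \<omega>) = (\<Sum>k=1..n. cond_mean k (X i \<omega>)) / real n"
proof -
  have eq: "poisson_sol n = (\<lambda>x. g x + inverse (real n) * (\<Sum>k=1..<n. cond_mean k x))"
    by (simp add: poisson_sol_def fun_eq_iff field_simps)
  have sum: "chain_L2 (\<lambda>x. \<Sum>k=1..<n. cond_mean k x)" by (intro chain_L2_sum cond_mean_L2)
  have "AE \<omega> in M. \<forall>k. kernel_op Q (cond_mean k) (X i \<omega>) = cond_mean (Suc k) (X i \<omega>) - cond_mean 1 (X i \<omega>)"
    by (simp only: AE_all_countable kernel_op_cond_mean simp_thms)
  moreover have "AE \<omega> in M. kernel_op Q (\<lambda>x. \<Sum>k=1..<n. cond_mean k x) (X i \<omega>) = (\<Sum>k=1..<n. kernel_op Q (cond_mean k) (X i \<omega>))"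
    by (intro kernel_op_sum cond_mean_L2)
  moreover have "AE \<omega> in M. kernel_op Q (poisson_sol n) (X i \<omega>) =
      kernel_op Q g (X i \<omega>) + kernel_op Q (\<lambda>x. inverse (real n) * (\<Sum>k=1..<n. cond_mean k x)) (X i \<omega>)"
    unfolding eq by (intro kernel_op_add g_L2 chain_L2_cmult sum)
  ultimately show ?thesis
  proof eventually_elim
    case (elim \<omega>)
    let ?w = "\<lambda>k. cond_mean k (X i \<omega>)"
    have "kernel_op Q (poisson_sol n) (X i \<omega>) = ?w 1 + inverse (real n) * (\<Sum>k=1..<n. ?w (Suc k) - ?w 1)"
      unfolding elim(3) kernel_op_cmult using elim(1,2) by (simp add: cond_mean_def)
    also have "(\<Sum>k=1..<n. ?w (Suc k) - ?w 1) = (\<Sum>k=1..<n. ?w (Suc k)) - (real n - 1) * ?w 1"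
      using n by (simp add: sum_subtractf of_nat_diff)
    also have "(\<Sum>k=1..<n. ?w (Suc k)) = (\<Sum>k=1..n. ?w k) - ?w 1"
      using n by (induction n rule: dec_induct) (simp_all)
    finally show ?case using n by (simp add: field_simps)
  qed
qed

lemma poisson_sol_residual:
  assumes n: "n \<ge> 1"
  shows "AE \<omega> in M. poisson_sol n (X i \<omega>) - kernel_op Q (poisson_sol n) (X i \<omega>) - g (X i \<omega>) =
    - (cond_mean n (X i \<omega>) / real n)"
  using kernel_op_poisson_sol[OF n, of i]
proof eventually_elim
  case (elim \<omega>)
  have "(\<Sum>k=1..n. cond_mean k (X i \<omega>)) = (\<Sum>k=1..<n. cond_mean k (X i \<omega>)) + cond_mean n (X i \<omega>)"
    using n by (cases n) (simp_all add: atLeastLessThanSuc_atLeastAtMost)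
  thus ?case unfolding elim poisson_sol_def by (simp add: add_divide_distrib)
qed

lemma poisson_sol_residual_norm:
  assumes n: "n \<ge> 1"
  shows "real n * norm_L2 M (\<lambda>\<omega>. poisson_sol n (X 0 \<omega>) - kernel_op Q (poisson_sol n) (X 0 \<omega>) - g (X 0 \<omega>)) = cond_norm n"
proof -
  have [measurable]: "poisson_sol n \<in> borel_measurable N" "cond_mean n \<in> borel_measurable N"
    using poisson_sol_L2 cond_mean_L2 by simp_all
  have "norm_L2 M (\<lambda>\<omega>. poisson_sol n (X 0 \<omega>) - kernel_op Q (poisson_sol n) (X 0 \<omega>) - g (X 0 \<omega>)) =
      norm_L2 M (\<lambda>\<omega>. - (cond_mean n (X 0 \<omega>) / real n))"
    by (rule norm_L2_AE_cong[OF poisson_sol_residual[OF n]]) measurable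
  also have "\<dots> = cond_norm n / real n" by (simp add: norm_L2_minus norm_L2_divide cond_norm_def)
  finally show ?thesis using n by simp
qed

lemma cond_mean_sum_norm:
  assumes "\<And>k. k \<in> I \<Longrightarrow> cond_norm k \<le> B"
  shows "norm_L2 M (\<lambda>\<omega>. \<Sum>k\<in>I. cond_mean k (X 0 \<omega>)) \<le> real (card I) * B"
  by (rule norm_L2_sum_bound) (use cond_mean_L2 assms in \<open>auto simp: cond_norm_def\<close>)

lemma kernel_op_poisson_sol_norm:
  assumes n: "n \<ge> 1" and B: "\<And>k. k \<in> {1..n} \<Longrightarrow> cond_norm k \<le> B"
  shows "norm_L2 M (\<lambda>\<omega>. kernel_op Q (poisson_sol n) (X 0 \<omega>)) \<le> B"
proof -
  have [measurable]: "poisson_sol n \<in> borel_measurable N" "cond_mean k \<in> borel_measurable N" for k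
    using poisson_sol_L2 cond_mean_L2 by simp_all
  have "norm_L2 M (\<lambda>\<omega>. kernel_op Q (poisson_sol n) (X 0 \<omega>)) =
      norm_L2 M (\<lambda>\<omega>. (\<Sum>k=1..n. cond_mean k (X 0 \<omega>)) / real n)"
    by (rule norm_L2_AE_cong[OF kernel_op_poisson_sol[OF n]]) measurable
  also have "\<dots> = norm_L2 M (\<lambda>\<omega>. \<Sum>k=1..n. cond_mean k (X 0 \<omega>)) / real n" by (simp add: norm_L2_divide)
  also have "\<dots> \<le> real (card {1..n}) * B / real n" by (intro divide_right_mono cond_mean_sum_norm B) auto
  also have "\<dots> = B" using n by simp
  finally show ?thesis .
qed

lemma poisson_sol_norm:
  assumes B: "\<And>k. k \<le> n \<Longrightarrow> cond_norm k \<le> B"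
  shows "norm_L2 M (\<lambda>\<omega>. poisson_sol n (X 0 \<omega>)) \<le> norm_L2 M (\<lambda>\<omega>. g (X 0 \<omega>)) + B"
proof -
  have B0: "B \<ge> 0" using B[of 0] cond_norm_nonneg[of 0] by linarith
  have "norm_L2 M (\<lambda>\<omega>. poisson_sol n (X 0 \<omega>)) \<le> norm_L2 M (\<lambda>\<omega>. g (X 0 \<omega>)) +
      norm_L2 M (\<lambda>\<omega>. (\<Sum>k=1..<n. cond_mean k (X 0 \<omega>)) / real n)"
    unfolding poisson_sol_def by (intro norm_L2_add in_L2_divide in_L2_sum chain_L2_X g_L2 cond_mean_L2)
  also have "norm_L2 M (\<lambda>\<omega>. (\<Sum>k=1..<n. cond_mean k (X 0 \<omega>)) / real n) =
      norm_L2 M (\<lambda>\<omega>. \<Sum>k=1..<n. cond_mean k (X 0 \<omega>)) / real n" by (simp add: norm_L2_divide)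
  also have "\<dots> \<le> real (card {1..<n}) * B / real n"
    by (intro divide_right_mono cond_mean_sum_norm B) auto
  \<comment> \<open>The hypothesis at k = 0 supplied B \<ge> 0, which lets n - 1 be replaced by n;
    for n = 0 the quotient is 0 by convention.\<close>
  also have "\<dots> \<le> B" using B0 by (cases "n = 0") (simp_all add: field_simps of_nat_diff)
  finally show ?thesis by simp
qed

text \<open>The bound keeps the norm of Q h rather than that of h: for the averaged solutions, Q h
  is an average of the w_k without the additional g, and the constant 3 depends on this.\<close>

lemma poisson_error:
  assumes h: "chain_L2 h"
  defines "r \<equiv> norm_L2 M (\<lambda>\<omega>. h (X 0 \<omega>) - kernel_op Q h (X 0 \<omega>) - g (X 0 \<omega>))"
  shows "in_L2 M (\<lambda>\<omega>. psum X g k \<omega> - (\<Sum>j=1..k. poisson_difference h j \<omega>))"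
    and "norm_L2 M (\<lambda>\<omega>. psum X g k \<omega> - (\<Sum>j=1..k. poisson_difference h j \<omega>))
      \<le> real k * r + 2 * norm_L2 M (\<lambda>\<omega>. kernel_op Q h (X 0 \<omega>))"
proof -
  show "in_L2 M (\<lambda>\<omega>. psum X g k \<omega> - (\<Sum>j=1..k. poisson_difference h j \<omega>))"
    by (intro in_L2_diff psum_L2 in_L2_sum poisson_difference_L2 h)
  define R where "R = (\<lambda>x. h x - kernel_op Q h x - g x)"
  note Qh = kernel_op_L2[OF h]
  have R: "chain_L2 R" unfolding R_def by (intro chain_L2_diff h Qh g_L2)
  \<comment> \<open>Inserting Q h(X_j) splits the j-th difference into R(X_j) + g(X_j) and an
    increment of Q h along the path; the increments telescope.\<close>
  have eq: "psum X g k \<omega> - (\<Sum>j=1..k. poisson_difference h j \<omega>) =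
      (kernel_op Q h (X 0 \<omega>) - kernel_op Q h (X (int k) \<omega>)) - (\<Sum>j=1..k. R (X (int j) \<omega>))" for \<omega>
    by (induction k) (simp_all add: psum_def poisson_difference_def R_def)
  have "norm_L2 M (\<lambda>\<omega>. psum X g k \<omega> - (\<Sum>j=1..k. poisson_difference h j \<omega>)) \<le>
      norm_L2 M (\<lambda>\<omega>. kernel_op Q h (X 0 \<omega>) - kernel_op Q h (X (int k) \<omega>)) +
      norm_L2 M (\<lambda>\<omega>. \<Sum>j=1..k. R (X (int j) \<omega>))"
    unfolding eq by (intro norm_L2_diff in_L2_diff in_L2_sum chain_L2_X Qh R)
  also have "norm_L2 M (\<lambda>\<omega>. kernel_op Q h (X 0 \<omega>) - kernel_op Q h (X (int k) \<omega>)) \<le>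
      norm_L2 M (\<lambda>\<omega>. kernel_op Q h (X 0 \<omega>)) + norm_L2 M (\<lambda>\<omega>. kernel_op Q h (X (int k) \<omega>))"
    by (intro norm_L2_diff chain_L2_X Qh)
  also have "norm_L2 M (\<lambda>\<omega>. kernel_op Q h (X (int k) \<omega>)) = norm_L2 M (\<lambda>\<omega>. kernel_op Q h (X 0 \<omega>))"
    by (rule norm_L2_marginal) (use Qh in simp)
  also have "norm_L2 M (\<lambda>\<omega>. \<Sum>j=1..k. R (X (int j) \<omega>)) \<le> real (card {1..k}) * r"
  proof (rule norm_L2_sum_bound)
    fix j
    show "in_L2 M (\<lambda>\<omega>. R (X (int j) \<omega>))" by (intro chain_L2_X R)
    have "norm_L2 M (\<lambda>\<omega>. R (X (int j) \<omega>)) = norm_L2 M (\<lambda>\<omega>. R (X 0 \<omega>))"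
      by (rule norm_L2_marginal) (use R in simp)
    thus "norm_L2 M (\<lambda>\<omega>. R (X (int j) \<omega>)) \<le> r" by (simp add: r_def R_def)
  qed
  finally show "norm_L2 M (\<lambda>\<omega>. psum X g k \<omega> - (\<Sum>j=1..k. poisson_difference h j \<omega>))
      \<le> real k * r + 2 * norm_L2 M (\<lambda>\<omega>. kernel_op Q h (X 0 \<omega>))" by simp
qed

text \<open>Projecting the error on F_0 removes the martingale and leaves w_n(X_0), and projections
  do not increase the norm.\<close>

lemma cond_mean_le_error:
  assumes D: "martingale_differences M (past_alg M N X) D"
    and L2: "in_L2 M (\<lambda>\<omega>. psum X g n \<omega> - (\<Sum>j=1..n. D j \<omega>))"
  shows "cond_norm n \<le> norm_L2 M (\<lambda>\<omega>. psum X g n \<omega> - (\<Sum>j=1..n. D j \<omega>))"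
proof -
  let ?F = "past_alg M N X 0"
  interpret F: sigma_finite_subalgebra M ?F by (rule sigma_finite_subalg[OF past_subalgebra])
  have [measurable]: "cond_mean n \<in> borel_measurable N" using cond_mean_L2 by simp
  have "AE \<omega> in M. real_cond_exp M ?F (\<lambda>\<omega>. psum X g n \<omega> - (\<Sum>j=1..n. D j \<omega>)) \<omega> =
      real_cond_exp M ?F (psum X g n) \<omega> - real_cond_exp M ?F (\<lambda>\<omega>. \<Sum>j=1..n. D j \<omega>) \<omega>"
    by (intro F.real_cond_exp_diff in_L2_integrable psum_L2 Bochner_Integration.integrable_sum
        martingale_differences_integrable[OF D]) simp
  with cond_exp_psum[of n] martingale_cond_exp_0[OF D, of n]
  have "AE \<omega> in M. cond_mean n (X 0 \<omega>) = real_cond_exp M ?F (\<lambda>\<omega>. psum X g n \<omega> - (\<Sum>j=1..n. D j \<omega>)) \<omega>"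
    by eventually_elim simp
  hence "cond_norm n = norm_L2 M (real_cond_exp M ?F (\<lambda>\<omega>. psum X g n \<omega> - (\<Sum>j=1..n. D j \<omega>)))"
    unfolding cond_norm_def by (rule norm_L2_AE_cong) measurable
  also have "\<dots> \<le> norm_L2 M (\<lambda>\<omega>. psum X g n \<omega> - (\<Sum>j=1..n. D j \<omega>))"
    by (intro F.real_cond_exp_L2 L2 in_L2_integrable)
  finally show ?thesis .
qed

end

section \<open>Martingale approximations\<close>

locale growing_functional = additive_functional +
  assumes s_inf: "filterlim (\<lambda>n. norm_L2 M (psum X g n)) at_top sequentially"
begin

section \<open>Error bounds and variances of martingale approximations\<close>

lemma sigma_sq_eq: "sigma_sq M X g n = (s n)\<^sup>2"
  by (simp add: sigma_sq_def norm_L2_sq)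

lemma almost_additive: "cond_norm \<in> o(\<lambda>n. s n) \<Longrightarrow> almost_additive (\<lambda>n. s n) cond_norm"
  by unfold_locales (auto simp: second_moment_almost_additive s_inf)

lemma martingale_approximationI:
  assumes md: "\<And>n. n \<ge> 1 \<Longrightarrow> martingale_differences M (past_alg M N X) (D n)"
    and L2: "\<And>n k. 1 \<le> k \<Longrightarrow> k \<le> n \<Longrightarrow> in_L2 M (\<lambda>\<omega>. psum X g k \<omega> - (\<Sum>j=1..k. D n j \<omega>))"
    and err: "\<And>n k. 1 \<le> k \<Longrightarrow> k \<le> n \<Longrightarrow> norm_L2 M (\<lambda>\<omega>. psum X g k \<omega> - (\<Sum>j=1..k. D n j \<omega>)) \<le> b n"
    and b: "b \<in> o(\<lambda>n. s n)"
  shows "martingale_approximation M N X g D"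
  unfolding martingale_approximation_def
proof (intro conjI allI impI)
  show "\<forall>\<^sub>F n in sequentially. \<forall>k\<in>{1..n}. in_L2 M (\<lambda>\<omega>. psum X g k \<omega> - (\<Sum>j=1..k. D n j \<omega>))"
    using L2 by (intro always_eventually) simp
  define E where "E = (\<lambda>n k. \<integral>\<omega>. (psum X g k \<omega> - (\<Sum>j=1..k. D n j \<omega>))\<^sup>2 \<partial>M)"
  have "(\<lambda>n. MAX k\<in>{1..n}. E n k) \<in> O(\<lambda>n. (b n)\<^sup>2)"
  proof (rule landau_o.bigI[of 1])
    show "\<forall>\<^sub>F n in sequentially. norm (MAX k\<in>{1..n}. E n k) \<le> 1 * norm ((b n)\<^sup>2)"
      \<comment> \<open>For n = 0 the maximum runs over the empty set and has no specified
        value.\<close>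
      using eventually_ge_at_top[of 1]
    proof eventually_elim
      case (elim n)
      have "E n k \<le> (b n)\<^sup>2" if "k \<in> {1..n}" for k
        using power_mono[OF err norm_L2_nonneg, of k n 2] that by (simp add: norm_L2_sq E_def)
      hence "(MAX k\<in>{1..n}. E n k) \<le> (b n)\<^sup>2" using elim by simp
      moreover have "0 \<le> E n 1" by (simp add: E_def)
      hence "0 \<le> (MAX k\<in>{1..n}. E n k)" using elim by (auto intro: order_trans[OF _ Max_ge])
      ultimately show ?case by simp
    qed
  qed simp
  also have "(\<lambda>n. (b n)\<^sup>2) \<in> o(\<lambda>n. (s n)\<^sup>2)"
    unfolding power2_eq_square by (intro landau_o.small_mult b)
  finally show "(\<lambda>n. MAX k\<in>{1..n}. \<integral>\<omega>. (psum X g k \<omega> - (\<Sum>j=1..k. D n j \<omega>))\<^sup>2 \<partial>M) \<in> o(\<lambda>n. sigma_sq M X g n)"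
    by (simp add: E_def sigma_sq_eq)
qed (rule md)

lemma martingale_approximationD:
  assumes D: "martingale_approximation M N X g D" and c: "c > 0"
  shows "\<forall>\<^sub>F n in sequentially. \<forall>k\<in>{1..n}. in_L2 M (\<lambda>\<omega>. psum X g k \<omega> - (\<Sum>j=1..k. D n j \<omega>)) \<and>
    norm_L2 M (\<lambda>\<omega>. psum X g k \<omega> - (\<Sum>j=1..k. D n j \<omega>)) \<le> c * s n"
proof -
  define E where "E = (\<lambda>n k. \<integral>\<omega>. (psum X g k \<omega> - (\<Sum>j=1..k. D n j \<omega>))\<^sup>2 \<partial>M)"
  have "(\<lambda>n. MAX k\<in>{1..n}. E n k) \<in> o(\<lambda>n. (s n)\<^sup>2)"
    using D by (simp add: martingale_approximation_def E_def sigma_sq_eq[abs_def])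
  from landau_o.smallD[OF this, of "c\<^sup>2"] c
  have "\<forall>\<^sub>F n in sequentially. norm (MAX k\<in>{1..n}. E n k) \<le> c\<^sup>2 * norm ((s n)\<^sup>2)" by simp
  moreover have "\<forall>\<^sub>F n in sequentially. \<forall>k\<in>{1..n}. in_L2 M (\<lambda>\<omega>. psum X g k \<omega> - (\<Sum>j=1..k. D n j \<omega>))"
    using D by (simp add: martingale_approximation_def)
  ultimately show ?thesis
  proof eventually_elim
    case (elim n)
    show ?case
    proof (intro ballI conjI)
      fix k assume k: "k \<in> {1..n}"
      show "in_L2 M (\<lambda>\<omega>. psum X g k \<omega> - (\<Sum>j=1..k. D n j \<omega>))" using elim(2) k by blast
      have "(norm_L2 M (\<lambda>\<omega>. psum X g k \<omega> - (\<Sum>j=1..k. D n j \<omega>)))\<^sup>2 = E n k" by (simp add: norm_L2_sq E_def)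
      also have "\<dots> \<le> (MAX k\<in>{1..n}. E n k)" using k by (intro Max_ge) auto
      also have "\<dots> \<le> c\<^sup>2 * (s n)\<^sup>2" using elim(1) by simp
      also have "\<dots> = (c * s n)\<^sup>2" by (simp add: power_mult_distrib)
      finally show "norm_L2 M (\<lambda>\<omega>. psum X g k \<omega> - (\<Sum>j=1..k. D n j \<omega>)) \<le> c * s n"
        by (rule power2_le_imp_le) (use c in simp)
    qed
  qed
qed

text \<open>Serves both (iii) to (i) and (iv) to (i): the error at k = n dominates its projection on
  F_0.\<close>

lemma approximation_imp_small:
  assumes D: "martingale_approximation M N X g D"
  shows "cond_norm \<in> o(\<lambda>n. s n)"
proof (rule landau_o.smallI)
  fix c :: real assume "c > 0"
  from martingale_approximationD[OF D this] eventually_ge_at_top[of 1]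
  show "\<forall>\<^sub>F n in sequentially. norm (cond_norm n) \<le> c * norm (s n)"
  proof eventually_elim
    case (elim n)
    have "martingale_differences M (past_alg M N X) (D n)"
      using D elim(2) by (simp add: martingale_approximation_def)
    note cond_mean_le_error[OF this conjunct1[OF bspec[OF elim(1)]], of n]
    also have "norm_L2 M (\<lambda>\<omega>. psum X g n \<omega> - (\<Sum>j=1..n. D n j \<omega>)) \<le> c * s n"
      using elim(2) by (intro conjunct2[OF bspec[OF elim(1)]]) simp
    finally show ?case using elim(2) by simp
  qed
qed

lemma poisson_imp_stationary:
  assumes h: "\<And>n. chain_L2 (h n)"
    and small: "(\<lambda>n. norm_L2 M (\<lambda>\<omega>. h n (X 0 \<omega>)) + real n *
      norm_L2 M (\<lambda>\<omega>. h n (X 0 \<omega>) - kernel_op Q (h n) (X 0 \<omega>) - g (X 0 \<omega>))) \<in> o(\<lambda>n. s n)"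
  shows "martingale_approximation M N X g (\<lambda>n. poisson_difference (h n))"
    and "stationary_array M (\<lambda>n. poisson_difference (h n))"
proof -
  let ?b = "\<lambda>n. norm_L2 M (\<lambda>\<omega>. h n (X 0 \<omega>)) + real n *
      norm_L2 M (\<lambda>\<omega>. h n (X 0 \<omega>) - kernel_op Q (h n) (X 0 \<omega>) - g (X 0 \<omega>))"
  show "stationary_array M (\<lambda>n. poisson_difference (h n))"
    unfolding stationary_array_def using h poisson_difference_stationary by blast
  show "martingale_approximation M N X g (\<lambda>n. poisson_difference (h n))"
  proof (rule martingale_approximationI)
    fix n k :: nat assume k: "1 \<le> k" "k \<le> n"
    let ?r = "norm_L2 M (\<lambda>\<omega>. h n (X 0 \<omega>) - kernel_op Q (h n) (X 0 \<omega>) - g (X 0 \<omega>))"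
    have "norm_L2 M (\<lambda>\<omega>. psum X g k \<omega> - (\<Sum>j=1..k. poisson_difference (h n) j \<omega>))
        \<le> real k * ?r + 2 * norm_L2 M (\<lambda>\<omega>. kernel_op Q (h n) (X 0 \<omega>))"
      by (rule poisson_error(2)[OF h])
    \<comment> \<open>Contractivity of Q replaces Q h by h; the residual is doubled merely to make
      the bound a multiple of the given small quantity.\<close>
    also have "\<dots> \<le> 2 * (real n * ?r) + 2 * norm_L2 M (\<lambda>\<omega>. h n (X 0 \<omega>))"
    proof (intro add_mono mult_left_mono kernel_op_norm h)
      have "real k * ?r \<le> real n * ?r" using k by (intro mult_right_mono) auto
      moreover have "0 \<le> real n * ?r" by simp
      ultimately show "real k * ?r \<le> 2 * (real n * ?r)" by linarith
    qed simp
    finally show "norm_L2 M (\<lambda>\<omega>. psum X g k \<omega> - (\<Sum>j=1..k. poisson_difference (h n) j \<omega>)) \<le> 2 * ?b n"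
      by simp
    show "in_L2 M (\<lambda>\<omega>. psum X g k \<omega> - (\<Sum>j=1..k. poisson_difference (h n) j \<omega>))"
      by (rule poisson_error(1)[OF h])
  next
    show "(\<lambda>n. 2 * ?b n) \<in> o(\<lambda>n. s n)" by (rule landau_o.small.cmult_in_iff[THEN iffD2, OF _ small]) simp
  qed (rule poisson_difference_martingale[OF h])
qed

text \<open>Orthogonality and stationarity give n E(D_{n1}^2) = \<open>(m n)\<^sup>2\<close>, and
  the triangle inequality in both directions puts \<open>m n\<close> within o(sigma_n) of
  sigma_n.\<close>

lemma stationary_variance:
  assumes D: "martingale_approximation M N X g D" and st: "stationary_array M D"
  shows "(\<lambda>n. \<integral>\<omega>. (D n 1 \<omega>)\<^sup>2 \<partial>M) \<sim>[sequentially] (\<lambda>n. sigma_sq M X g n / real n)"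
proof -
  define m where "m = (\<lambda>n. norm_L2 M (\<lambda>\<omega>. \<Sum>j=1..n. D n j \<omega>))"
  have pos: "\<forall>\<^sub>F n in sequentially. s n \<ge> 1" using s_inf by (simp add: filterlim_at_top)
  have main: "\<forall>\<^sub>F n in sequentially. n * (\<integral>\<omega>. (D n 1 \<omega>)\<^sup>2 \<partial>M) = (m n)\<^sup>2 \<and> \<bar>m n - s n\<bar> \<le> c * s n"
    if c: "c > 0" for c :: real
    using martingale_approximationD[OF D c] eventually_ge_at_top[of 1]
  proof eventually_elim
    case (elim n)
    have md: "martingale_differences M (past_alg M N X) (D n)"
      using D elim(2) by (simp add: martingale_approximation_def)
    \<comment> \<open>An approximation comes with square integrability of its errors. Subtracting
      the error from S_k recovers it for the martingale, and consecutive martingale values then give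
      it for the differences.\<close>
    have ML2: "in_L2 M (\<lambda>\<omega>. \<Sum>j=1..k. D n j \<omega>)" if "k \<le> n" for k
    proof (cases "k = 0")
      case False
      have "in_L2 M (\<lambda>\<omega>. psum X g k \<omega> - (psum X g k \<omega> - (\<Sum>j=1..k. D n j \<omega>)))"
        by (intro in_L2_diff psum_L2 conjunct1[OF bspec[OF elim(1)]]) (use that False in simp)
      thus ?thesis by simp
    qed (simp add: in_L2_zero)
    have DL2: "in_L2 M (D n j)" if j: "j \<in> {1..n}" for j
    proof -
      have "in_L2 M (\<lambda>\<omega>. (\<Sum>i=1..j. D n i \<omega>) - (\<Sum>i=1..j-1. D n i \<omega>))"
        using j by (intro in_L2_diff ML2) auto
      moreover have "(\<lambda>\<omega>. (\<Sum>i=1..j. D n i \<omega>) - (\<Sum>i=1..j-1. D n i \<omega>)) = D n j"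
        using j by (cases j) auto
      ultimately show ?thesis by simp
    qed
    have "(m n)\<^sup>2 = (\<Sum>j=1..n. \<integral>\<omega>. (D n j \<omega>)\<^sup>2 \<partial>M)"
      unfolding m_def norm_L2_sq by (rule martingale_orthogonality[OF md DL2])
    also have "\<dots> = (\<Sum>j=1..n. \<integral>\<omega>. (D n 1 \<omega>)\<^sup>2 \<partial>M)"
      using st elim(2) by (intro sum.cong refl stationary_second_moment) (auto simp: stationary_array_def)
    finally have 1: "n * (\<integral>\<omega>. (D n 1 \<omega>)\<^sup>2 \<partial>M) = (m n)\<^sup>2" by simp
    let ?R = "\<lambda>\<omega>. psum X g n \<omega> - (\<Sum>j=1..n. D n j \<omega>)"
    have R: "in_L2 M ?R" "norm_L2 M ?R \<le> c * s n" using bspec[OF elim(1), of n] elim(2) by simp_all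
    have "norm_L2 M (\<lambda>\<omega>. psum X g n \<omega> - ?R \<omega>) \<le> s n + norm_L2 M ?R" by (intro norm_L2_diff psum_L2 R)
    hence 2: "m n \<le> s n + norm_L2 M ?R" by (simp add: m_def)
    have "norm_L2 M (\<lambda>\<omega>. ?R \<omega> + (\<Sum>j=1..n. D n j \<omega>)) \<le> norm_L2 M ?R + m n"
      unfolding m_def by (intro norm_L2_add R ML2 order_refl)
    hence "s n \<le> norm_L2 M ?R + m n" by simp
    with 1 2 R(2) show ?case by (simp add: abs_le_iff)
  qed
  have "(\<lambda>n. m n / s n) \<longlonglongrightarrow> 1"
  proof (rule tendstoI)
    fix \<epsilon> :: real assume \<epsilon>: "\<epsilon> > 0"
    show "\<forall>\<^sub>F n in sequentially. dist (m n / s n) 1 < \<epsilon>"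
      using main[of "\<epsilon>/2", simplified, OF \<epsilon>] pos
    proof eventually_elim
      case (elim n)
      have sn: "s n > 0" using elim(2) by linarith
      have "dist (m n / s n) 1 = \<bar>(m n - s n) / s n\<bar>" using sn by (simp add: dist_real_def diff_divide_distrib)
      also have "\<dots> = \<bar>m n - s n\<bar> / s n" using sn by simp
      also have "\<dots> \<le> \<epsilon>/2" using elim sn by (simp add: pos_divide_le_eq)
      also have "\<dots> < \<epsilon>" using \<epsilon> by simp
      finally show ?case .
    qed
  qed
  from tendsto_power[OF this, of 2] have lim: "(\<lambda>n. (m n / s n)\<^sup>2) \<longlonglongrightarrow> 1" by simp
  show ?thesis
  proof (rule asymp_equivI', rule Lim_transform_eventually[OF lim])
    show "\<forall>\<^sub>F n in sequentially. (m n / s n)\<^sup>2 = (\<integral>\<omega>. (D n 1 \<omega>)\<^sup>2 \<partial>M) / (sigma_sq M X g n / real n)"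
      using main[OF zero_less_one] eventually_ge_at_top[of 1]
      by eventually_elim (auto simp: sigma_sq_eq power_divide mult.commute)
  qed
qed

section \<open>Dyadic blocks; \<open>dyad n\<close> is the ceiling of log_2 n for n \<ge> 1\<close>

definition dyad :: "nat \<Rightarrow> nat" where
  "dyad n = (LEAST p. n \<le> 2 ^ p)"

lemma dyad_ge: "n \<le> 2 ^ dyad n"
  unfolding dyad_def by (rule LeastI[of _ n]) (simp add: less_imp_le)

lemma dyad_le: "n \<le> 2 ^ p \<Longrightarrow> dyad n \<le> p"
  unfolding dyad_def by (rule Least_le)

lemma dyad_eq:
  assumes "2 ^ i < n" "n \<le> 2 ^ Suc i"
  shows "dyad n = Suc i"
proof -
  have "\<not> dyad n \<le> i"
  proof
    assume "dyad n \<le> i"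
    hence "(2::nat) ^ dyad n \<le> 2 ^ i" by (rule power_increasing) simp
    with dyad_ge[of n] assms(1) show False by linarith
  qed
  with dyad_le[OF assms(2)] show ?thesis by simp
qed

lemma dyad_at_top: "filterlim dyad at_top sequentially"
  unfolding filterlim_at_top
proof
  fix Z
  show "\<forall>\<^sub>F n in sequentially. Z \<le> dyad n"
    using eventually_gt_at_top[of "2 ^ Z"]
  proof eventually_elim
    case (elim n)
    show ?case
    proof (rule ccontr)
      assume "\<not> Z \<le> dyad n"
      hence "(2::nat) ^ dyad n \<le> 2 ^ Z" by (intro power_increasing) auto
      with dyad_ge[of n] elim show False by linarith
    qed
  qed
qed

text \<open>The error is first bounded along powers of 2, where \<open>geometric_smallo\<close>
  applies; the bound is then carried to every n at the cost of a constant factor.\<close>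

lemma nontriangular_approximation:
  fixes D :: "nat \<Rightarrow> nat \<Rightarrow> 'a \<Rightarrow> real"
  assumes small: "cond_norm \<in> o(\<lambda>n. s n)"
    and md: "\<And>n. n \<ge> 1 \<Longrightarrow> martingale_differences M (past_alg M N X) (D n)"
    and L2: "\<And>n j. in_L2 M (D n j)"
    and err: "\<And>n k. 1 \<le> k \<Longrightarrow> k \<le> n \<Longrightarrow> norm_L2 M (\<lambda>\<omega>. psum X g k \<omega> - (\<Sum>j=1..k. D n j \<omega>)) \<le> b n"
    and b: "b \<in> o(\<lambda>n. s n)"
  shows "martingale_approximation M N X g (\<lambda>n j. D (2 ^ dyad j) j)"
proof -
  interpret almost_additive "\<lambda>n. s n" cond_norm by (rule almost_additive[OF small])
  define D' where "D' = (\<lambda>j. D (2 ^ dyad j) j)"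
  define R where "R = (\<lambda>k \<omega>. psum X g k \<omega> - (\<Sum>j=1..k. D' j \<omega>))"
  define E where "E = (\<lambda>n k \<omega>. psum X g k \<omega> - (\<Sum>j=1..k. D n j \<omega>))"
  have RL2: "in_L2 M (R k)" and EL2: "in_L2 M (E n k)" for n k
    unfolding R_def E_def D'_def by (intro in_L2_diff psum_L2 in_L2_sum L2)+
  have En: "norm_L2 M (E n k) \<le> b n" if "1 \<le> k" "k \<le> n" for n k
    using err[OF that] by (simp add: E_def)
  have b0: "b n \<ge> 0" if "n \<ge> 1" for n
    using En[of 1 n] that norm_L2_nonneg[of M "E n 1"] by linarith
  \<comment> \<open>Bounds the error up to time 2^i. Each block adds a difference of two errors of
    its own row, at the current time and at the start of the block, hence the factor 2.\<close>
  define u where "u = (\<lambda>i. 2 * (\<Sum>l\<le>i. b (2 ^ l)))"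
  have Ru: "norm_L2 M (R k) \<le> u i" if "k \<le> 2 ^ i" for i k
    using that
  proof (induction i arbitrary: k)
    case 0
    have b1: "b 1 \<ge> 0" by (rule b0) simp
    from 0 consider "k = 0" | "k = 1" by force
    thus ?case
    proof cases
      case 1
      hence "R k = (\<lambda>_. 0)" by (simp add: R_def psum_def fun_eq_iff)
      thus ?thesis using b1 by (simp add: norm_L2_def u_def)
    next
      case 2
      have "dyad 1 = 0" using dyad_le[of 1 0] by simp
      hence "R k = E 1 1" using 2 by (simp add: R_def E_def D'_def fun_eq_iff)
      thus ?thesis using En[of 1 1] b1 by (simp add: u_def)
    qed
  next
    case (Suc i)
    let ?n = "2 ^ Suc i :: nat"
    have ui: "u (Suc i) = u i + 2 * b ?n" by (simp add: u_def)
    show ?case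
    proof (cases "k \<le> 2 ^ i")
      case True
      have "b ?n \<ge> 0" by (rule b0) simp
      with Suc.IH[OF True] ui show ?thesis by linarith
    next
      case False
      \<comment> \<open>On the new block \<open>D'\<close> coincides with the row \<open>?n\<close>,
        so the error changes there exactly as the error of that row does.\<close>
      have "R k \<omega> = (E ?n k \<omega> - E ?n (2 ^ i) \<omega>) + R (2 ^ i) \<omega>" for \<omega>
      proof -
        have split: "(\<Sum>j=1..k. f j) = (\<Sum>j=1..2^i. f j) + (\<Sum>j=2^i+1..k. f j)" for f :: "nat \<Rightarrow> real"
          using False sum.ub_add_nat[of 1 "2 ^ i" f "k - 2 ^ i"] by simp
        have "(\<Sum>j=2^i+1..k. D' j \<omega>) = (\<Sum>j=2^i+1..k. D ?n j \<omega>)"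
        proof (rule sum.cong[OF refl])
          fix j assume "j \<in> {2 ^ i + 1..k}"
          hence "dyad j = Suc i" using Suc.prems by (intro dyad_eq) auto
          thus "D' j \<omega> = D ?n j \<omega>" by (simp add: D'_def)
        qed
        thus ?thesis unfolding R_def E_def split by simp
      qed
      hence "R k = (\<lambda>\<omega>. (E ?n k \<omega> - E ?n (2 ^ i) \<omega>) + R (2 ^ i) \<omega>)" by (rule ext)
      hence "norm_L2 M (R k) \<le> norm_L2 M (\<lambda>\<omega>. E ?n k \<omega> - E ?n (2 ^ i) \<omega>) + norm_L2 M (R (2 ^ i))"
        by (simp only:) (intro norm_L2_add in_L2_diff RL2 EL2)
      also have "norm_L2 M (\<lambda>\<omega>. E ?n k \<omega> - E ?n (2 ^ i) \<omega>) \<le> norm_L2 M (E ?n k) + norm_L2 M (E ?n (2 ^ i))"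
        by (intro norm_L2_diff EL2)
      also have "norm_L2 M (E ?n k) \<le> b ?n" using False Suc.prems by (intro En) auto
      also have "norm_L2 M (E ?n (2 ^ i)) \<le> b ?n" by (intro En) auto
      also have "norm_L2 M (R (2 ^ i)) \<le> u i" by (rule Suc.IH) simp
      finally show ?thesis using ui by linarith
    qed
  qed
  have pow: "filterlim (\<lambda>i. 2 ^ i :: nat) at_top sequentially"
    by (rule filterlim_subseq) (simp add: strict_mono_def)
  have u_small: "u \<in> o(\<lambda>i. s (2 ^ i))"
  proof (rule geometric_smallo)
    show "(\<lambda>i. 2 * b (2 ^ i)) \<in> o(\<lambda>i. s (2 ^ i))"
      using landau_o.small.compose[OF b pow] by simp
    show "\<forall>\<^sub>F i in sequentially. 4 / 3 * s (2 ^ i) \<le> s (2 ^ Suc i)"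
      using eventually_compose_filterlim[OF doubling_growth pow] by simp
    show "filterlim (\<lambda>i. s (2 ^ i)) at_top sequentially"
      by (rule filterlim_compose[OF s_inf pow])
    show "u i \<ge> 0" for i unfolding u_def by (intro mult_nonneg_nonneg sum_nonneg b0) auto
  qed (simp_all add: u_def)
  have pred: "filterlim (\<lambda>n. 2 ^ (dyad n - 1) :: nat) at_top sequentially"
    by (rule filterlim_compose[OF pow filterlim_compose[OF filterlim_minus_const_nat_at_top dyad_at_top]])
  have "(\<lambda>n. u (dyad n)) \<in> o(\<lambda>n. s (2 ^ dyad n))"
    by (rule landau_o.small.compose[OF u_small dyad_at_top])
  \<comment> \<open>Half of 2^(dyad n) is at most n by minimality. Doubling costs a factor 2 and
    almost monotonicity another 2; \<open>dyad n\<close> must be positive because subtraction is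
    truncated.\<close>
  also have "(\<lambda>n. s (2 ^ dyad n)) \<in> O(\<lambda>n. s n)"
  proof (rule landau_o.bigI[of 4])
    show "\<forall>\<^sub>F n in sequentially. norm (s (2 ^ dyad n)) \<le> 4 * norm (s n)"
      using eventually_compose_filterlim[OF doubling_bound pred] almost_mono
        eventually_compose_filterlim[OF eventually_ge_at_top[of 1] dyad_at_top]
    proof eventually_elim
      case (elim n)
      have "2 ^ (dyad n - 1) \<le> n"
      proof (rule ccontr)
        assume "\<not> 2 ^ (dyad n - 1) \<le> n"
        hence "dyad n \<le> dyad n - 1" by (intro dyad_le) simp
        thus False using elim(3) by simp
      qed
      hence "s (2 ^ (dyad n - 1)) \<le> 2 * s n" using elim(2) by blast
      moreover have "2 * 2 ^ (dyad n - 1) = (2 :: nat) ^ dyad n"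
        using elim(3) by (simp flip: power_Suc)
      ultimately show ?case using elim(1) by simp
    qed
  qed simp
  finally have ud: "(\<lambda>n. u (dyad n)) \<in> o(\<lambda>n. s n)" .
  show ?thesis
    unfolding D'_def[symmetric]
  proof (rule martingale_approximationI[OF _ _ _ ud])
    \<comment> \<open>The conditions concern each j separately, so entries taken from different rows
      still satisfy them.\<close>
    show "martingale_differences M (past_alg M N X) D'"
      using md unfolding martingale_differences_def D'_def by simp
    fix n k :: nat assume "1 \<le> k" "k \<le> n"
    show "in_L2 M (\<lambda>\<omega>. psum X g k \<omega> - (\<Sum>j = 1..k. D' j \<omega>))" using RL2[of k] by (simp add: R_def)
    show "norm_L2 M (\<lambda>\<omega>. psum X g k \<omega> - (\<Sum>j = 1..k. D' j \<omega>)) \<le> u (dyad n)"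
      using Ru[of k "dyad n"] dyad_ge[of n] \<open>k \<le> n\<close> by (simp add: R_def)
  qed
qed

text \<open>There are three contributions, each at most c/3 times sigma_n: the fixed norm of g, the
  average of the w_k by \<open>smallo_uniform\<close>, and n times the residual, which is exactly
  the norm of w_n.\<close>

lemma poisson_sol_small:
  assumes small: "cond_norm \<in> o(\<lambda>n. s n)"
  shows "(\<lambda>n. norm_L2 M (\<lambda>\<omega>. poisson_sol n (X 0 \<omega>)) + real n *
    norm_L2 M (\<lambda>\<omega>. poisson_sol n (X 0 \<omega>) - kernel_op Q (poisson_sol n) (X 0 \<omega>) - g (X 0 \<omega>))) \<in> o(\<lambda>n. s n)"
proof (rule landau_o.smallI)
  interpret almost_additive "\<lambda>n. s n" cond_norm by (rule almost_additive[OF small])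
  fix c :: real assume c: "c > 0"
  have "\<forall>\<^sub>F n in sequentially. \<forall>k\<le>n. cond_norm k \<le> c/3 * s n"
    by (rule smallo_uniform[OF small]) (use c in simp)
  moreover have "\<forall>\<^sub>F n in sequentially. s n \<ge> norm_L2 M (\<lambda>\<omega>. g (X 0 \<omega>)) / (c/3)" by (rule s_large)
  ultimately show "\<forall>\<^sub>F n in sequentially. norm (norm_L2 M (\<lambda>\<omega>. poisson_sol n (X 0 \<omega>)) + real n *
    norm_L2 M (\<lambda>\<omega>. poisson_sol n (X 0 \<omega>) - kernel_op Q (poisson_sol n) (X 0 \<omega>) - g (X 0 \<omega>))) \<le> c * norm (s n)"
    using eventually_ge_at_top[of 1]
  proof eventually_elim
    case (elim n)
    have "norm_L2 M (\<lambda>\<omega>. poisson_sol n (X 0 \<omega>)) \<le> norm_L2 M (\<lambda>\<omega>. g (X 0 \<omega>)) + c/3 * s n"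
      by (rule poisson_sol_norm) (use elim(1) in blast)
    moreover have "norm_L2 M (\<lambda>\<omega>. g (X 0 \<omega>)) \<le> c/3 * s n"
      using elim(2) c by (simp add: field_simps)
    moreover have "cond_norm n \<le> c/3 * s n" using elim(1) by blast
    ultimately show ?case unfolding poisson_sol_residual_norm[OF elim(3)] by simp
  qed
qed

text \<open>Of the constant 3, one unit is the accumulated residual, at most the norm of w_n; the
  other two are the end points of the telescoping term, each bounded by the average of the
  w_k.\<close>

lemma poisson_sol_error:
  assumes "1 \<le> k" "k \<le> n"
  shows "norm_L2 M (\<lambda>\<omega>. psum X g k \<omega> - (\<Sum>j=1..k. poisson_difference (poisson_sol n) j \<omega>))
    \<le> 3 * (MAX k\<in>{1..n}. cond_norm k)"
proof -
  let ?r = "norm_L2 M (\<lambda>\<omega>. poisson_sol n (X 0 \<omega>) - kernel_op Q (poisson_sol n) (X 0 \<omega>) - g (X 0 \<omega>))"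
  have n: "n \<ge> 1" using assms by simp
  have e_le: "cond_norm k \<le> (MAX k\<in>{1..n}. cond_norm k)" if "k \<in> {1..n}" for k using that by (intro Max_ge) auto
  have "real k * ?r \<le> real n * ?r" using assms by (intro mult_right_mono) auto
  also have "\<dots> = cond_norm n" by (rule poisson_sol_residual_norm[OF n])
  also have "\<dots> \<le> (MAX k\<in>{1..n}. cond_norm k)" using n by (intro e_le) simp
  finally have "real k * ?r \<le> (MAX k\<in>{1..n}. cond_norm k)" .
  moreover have "norm_L2 M (\<lambda>\<omega>. kernel_op Q (poisson_sol n) (X 0 \<omega>)) \<le> (MAX k\<in>{1..n}. cond_norm k)"
    by (rule kernel_op_poisson_sol_norm[OF n e_le])
  ultimately show ?thesis using poisson_error(2)[OF poisson_sol_L2, of k n] by linarith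
qed

text \<open>The rows come from the averaged Poisson solutions: \<open>poisson_sol_error\<close>
  bounds each row by a quantity depending on n alone, which is o(sigma_n) by
  \<open>smallo_uniform\<close>.\<close>

lemma small_imp_nontriangular:
  assumes small: "cond_norm \<in> o(\<lambda>n. s n)"
  shows "\<exists>D. martingale_approximation M N X g D \<and> nontriangular D"
proof -
  interpret almost_additive "\<lambda>n. s n" cond_norm by (rule almost_additive[OF small])
  have "(\<lambda>n. 3 * (MAX k\<in>{1..n}. cond_norm k)) \<in> o(\<lambda>n. s n)"
  proof (rule landau_o.smallI)
    fix c :: real assume c: "c > 0"
    have "\<forall>\<^sub>F n in sequentially. \<forall>k\<le>n. cond_norm k \<le> c/3 * s n"
      by (rule smallo_uniform[OF small]) (use c in simp)
    with eventually_ge_at_top[of 1] show "\<forall>\<^sub>F n in sequentially. norm (3 * (MAX k\<in>{1..n}. cond_norm k)) \<le> c * norm (s n)"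
    proof eventually_elim
      case (elim n)
      have "(MAX k\<in>{1..n}. cond_norm k) \<le> c/3 * s n"
        by (rule Max.boundedI) (use elim in auto)
      moreover have "0 \<le> (MAX k\<in>{1..n}. cond_norm k)"
        using elim(1) by (intro order_trans[OF cond_norm_nonneg[of 1] Max_ge]) auto
      ultimately show ?case by simp
    qed
  qed
  note b = this
  have "martingale_approximation M N X g
      (\<lambda>n j. (\<lambda>n. poisson_difference (poisson_sol n)) (2 ^ dyad j) j)"
  proof (rule nontriangular_approximation[OF small])
    show "martingale_differences M (past_alg M N X) (poisson_difference (poisson_sol n))" for n
      by (rule poisson_difference_martingale[OF poisson_sol_L2])
    show "in_L2 M (poisson_difference (poisson_sol n) j)" for n j
      by (rule poisson_difference_L2[OF poisson_sol_L2])
  qed (rule poisson_sol_error b; assumption?)+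
  moreover have "nontriangular (\<lambda>n j. poisson_difference (poisson_sol (2 ^ dyad j)) j)"
    unfolding nontriangular_def by (rule exI[of _ "\<lambda>j. poisson_difference (poisson_sol (2 ^ dyad j)) j"]) simp
  ultimately show ?thesis by (intro exI conjI)
qed

end

theorem theorem1:
  fixes M :: "'w measure" and N :: "'s measure" and X :: "int \<Rightarrow> 'w \<Rightarrow> 's"
    and Q :: "'s \<Rightarrow> 's measure" and g :: "'s \<Rightarrow> real"
    and \<pi> :: "'s measure" and S :: "nat \<Rightarrow> 'w \<Rightarrow> real" and \<sigma> \<l> :: "nat \<Rightarrow> real"
  defines "\<pi> \<equiv> distr M N (X 0)"
    and "S \<equiv> psum X g"
    and "\<sigma> \<equiv> (\<lambda>n. sqrt (sigma_sq M X g n))"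
    and "\<l> \<equiv> (\<lambda>n. sigma_sq M X g n / real n)"
  assumes prob: "prob_space M"
    and markov: "markov_chain M N X"
    and stationary: "stationary_process M N UNIV X"
    and ergodic: "ergodic_process M N X"
    and kernel: "regular_cond_distr M N (X 1) (X 0) Q"
    and g_meas: "g \<in> borel_measurable N"
    and g_sq: "integrable M (\<lambda>\<omega>. (g (X 0 \<omega>))\<^sup>2)"
    and g_mean: "(\<integral>\<omega>. g (X 0 \<omega>) \<partial>M) = 0"
    and sigma_inf: "filterlim (sigma_sq M X g) at_top sequentially"
  defines "cond_i \<equiv> (\<lambda>n. norm_L2 M (cond_psum M N X g n)) \<in> o(\<sigma>)"
    and "cond_ii \<equiv> \<exists>h. (\<forall>n. in_L2 \<pi> (h n)) \<and>
           (\<lambda>n. norm_L2 \<pi> (h n) +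
              real n * norm_L2 \<pi> (\<lambda>x. (h n x - kernel_op Q (h n) x) - g x)) \<in> o(\<sigma>)"
    and "cond_iii \<equiv> \<exists>D. martingale_approximation M N X g D \<and> stationary_array M D"
    and "cond_iv \<equiv> \<exists>D. martingale_approximation M N X g D \<and> nontriangular D"
  shows "(cond_i \<longleftrightarrow> cond_ii) \<and> (cond_ii \<longleftrightarrow> cond_iii) \<and> (cond_iii \<longleftrightarrow> cond_iv) \<and>
    (cond_i \<longrightarrow>
       slowly_varying \<l> \<and>
       (\<forall>D. martingale_approximation M N X g D \<and> stationary_array M D \<longrightarrow>
          (\<lambda>n. \<integral>\<omega>. (D n 1 \<omega>)\<^sup>2 \<partial>M) \<sim>[sequentially] \<l>) \<and>
       (\<exists>D. martingale_approximation M N X g D \<and> stationary_array M D \<and>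
          (\<forall>n\<ge>1. \<forall>k\<in>{1..n}. in_L2 M (\<lambda>\<omega>. S k \<omega> - (\<Sum>j=1..k. D n j \<omega>))) \<and>
          (\<forall>n\<ge>1. (MAX k\<in>{1..n}. norm_L2 M (\<lambda>\<omega>. S k \<omega> - (\<Sum>j=1..k. D n j \<omega>)))
             \<le> 3 * (MAX k\<in>{1..n}. norm_L2 M (cond_psum M N X g k)))))"
proof -
  interpret prob_space M by (rule prob)
  interpret additive_functional M N X Q g
    by unfold_locales (fact markov stationary kernel g_meas g_sq)+
  have \<sigma>: "\<sigma> = (\<lambda>n. norm_L2 M (psum X g n))"
    by (simp add: \<sigma>_def sigma_sq_def norm_L2_def)
  have \<sigma>_inf: "filterlim (\<lambda>n. norm_L2 M (psum X g n)) at_top sequentially"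
    unfolding \<sigma>[symmetric] \<sigma>_def by (rule filterlim_compose[OF sqrt_at_top sigma_inf])
  interpret growing_functional M N X Q g by unfold_locales (fact \<sigma>_inf)
  have \<l>: "\<l> = (\<lambda>n. (norm_L2 M (psum X g n))\<^sup>2 / real n)"
    by (simp add: \<l>_def sigma_sq_eq)
  have i: "cond_i \<longleftrightarrow> cond_norm \<in> o(\<lambda>n. norm_L2 M (psum X g n))"
    by (simp only: cond_i_def \<sigma> norm_cond_psum)
  \<comment> \<open>Norms in L2(pi) are pulled back to the probability space through
    \<open>X 0\<close>.\<close>
  have ii: "cond_ii \<longleftrightarrow> (\<exists>h. (\<forall>n. chain_L2 (h n)) \<and>
      (\<lambda>n. norm_L2 M (\<lambda>\<omega>. h n (X 0 \<omega>)) + real n *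
        norm_L2 M (\<lambda>\<omega>. h n (X 0 \<omega>) - kernel_op Q (h n) (X 0 \<omega>) - g (X 0 \<omega>))) \<in> o(\<lambda>n. norm_L2 M (psum X g n)))"
    unfolding cond_ii_def \<sigma> \<pi>_def in_L2_distr
  proof (intro ex_cong1 conj_cong refl)
    fix h :: "nat \<Rightarrow> 's \<Rightarrow> real" assume "\<forall>n. chain_L2 (h n)"
    hence hm [measurable]: "h n \<in> borel_measurable N" for n by blast
    have "norm_L2 (distr M N (X 0)) (h n) = norm_L2 M (\<lambda>\<omega>. h n (X 0 \<omega>))"
      and "norm_L2 (distr M N (X 0)) (\<lambda>x. h n x - kernel_op Q (h n) x - g x) =
        norm_L2 M (\<lambda>\<omega>. h n (X 0 \<omega>) - kernel_op Q (h n) (X 0 \<omega>) - g (X 0 \<omega>))" for n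
      by (rule norm_L2_distr, measurable)+
    thus "(\<lambda>n. norm_L2 (distr M N (X 0)) (h n) + real n * norm_L2 (distr M N (X 0))
          (\<lambda>x. h n x - kernel_op Q (h n) x - g x)) \<in> o(\<lambda>n. norm_L2 M (psum X g n)) \<longleftrightarrow>
        (\<lambda>n. norm_L2 M (\<lambda>\<omega>. h n (X 0 \<omega>)) + real n * norm_L2 M
          (\<lambda>\<omega>. h n (X 0 \<omega>) - kernel_op Q (h n) (X 0 \<omega>) - g (X 0 \<omega>))) \<in> o(\<lambda>n. norm_L2 M (psum X g n))"
      by (simp only:)
  qed
  \<comment> \<open>The implications run through (i), (ii), (iii) in one cycle and through (i), (iv)
    in a second one.\<close>
  have i_ii: "cond_ii" if cond_i
    unfolding ii by (intro exI[of _ poisson_sol] conjI allI poisson_sol_L2 poisson_sol_small that[unfolded i])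
  have ii_iii: "cond_iii" if cond_ii
  proof -
    from that[unfolded ii] obtain h where h: "\<forall>n. chain_L2 (h n)"
      and small: "(\<lambda>n. norm_L2 M (\<lambda>\<omega>. h n (X 0 \<omega>)) + real n * norm_L2 M
        (\<lambda>\<omega>. h n (X 0 \<omega>) - kernel_op Q (h n) (X 0 \<omega>) - g (X 0 \<omega>))) \<in> o(\<lambda>n. norm_L2 M (psum X g n))"
      by (elim exE conjE)
    show ?thesis
      unfolding cond_iii_def
      by (intro exI[of _ "\<lambda>n. poisson_difference (h n)"] conjI poisson_imp_stationary h[rule_format] small)
  qed
  have iii_i: "cond_i" if cond_iii
    using that approximation_imp_small unfolding i cond_iii_def by blast
  have i_iv: "cond_iv" if cond_i
    unfolding cond_iv_def by (rule small_imp_nontriangular[OF that[unfolded i]])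
  have iv_i: "cond_i" if cond_iv
    using that approximation_imp_small unfolding i cond_iv_def by blast
  show ?thesis
  proof (intro conjI impI)
    show "cond_i \<longleftrightarrow> cond_ii" "cond_ii \<longleftrightarrow> cond_iii" "cond_iii \<longleftrightarrow> cond_iv"
      using i_ii ii_iii iii_i i_iv iv_i by blast+
    assume cond_i
    hence small: "cond_norm \<in> o(\<lambda>n. norm_L2 M (psum X g n))" by (simp only: i)
    show "slowly_varying \<l>"
      unfolding \<l> by (rule almost_additive.slowly_varying[OF almost_additive[OF small]])
    show "\<forall>D. martingale_approximation M N X g D \<and> stationary_array M D \<longrightarrow>
        (\<lambda>n. \<integral>\<omega>. (D n 1 \<omega>)\<^sup>2 \<partial>M) \<sim>[sequentially] \<l>"
      unfolding \<l>_def using stationary_variance by blast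
    \<comment> \<open>The averaged solutions that prove (ii) also give the array with the explicit
      constant 3.\<close>
    let ?D = "\<lambda>n. poisson_difference (poisson_sol n)"
    have "martingale_approximation M N X g ?D" "stationary_array M ?D"
      by (rule poisson_imp_stationary[OF poisson_sol_L2 poisson_sol_small[OF small]])+
    moreover have "in_L2 M (\<lambda>\<omega>. S k \<omega> - (\<Sum>j=1..k. ?D n j \<omega>))" for n k
      unfolding S_def by (rule poisson_error(1)[OF poisson_sol_L2])
    moreover have "(MAX k\<in>{1..n}. norm_L2 M (\<lambda>\<omega>. S k \<omega> - (\<Sum>j=1..k. ?D n j \<omega>)))
        \<le> 3 * (MAX k\<in>{1..n}. norm_L2 M (cond_psum M N X g k))" if "n \<ge> 1" for n
      unfolding S_def norm_cond_psum
      by (rule Max.boundedI) (use that poisson_sol_error in auto)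
    ultimately show "\<exists>D. martingale_approximation M N X g D \<and> stationary_array M D \<and>
          (\<forall>n\<ge>1. \<forall>k\<in>{1..n}. in_L2 M (\<lambda>\<omega>. S k \<omega> - (\<Sum>j=1..k. D n j \<omega>))) \<and>
          (\<forall>n\<ge>1. (MAX k\<in>{1..n}. norm_L2 M (\<lambda>\<omega>. S k \<omega> - (\<Sum>j=1..k. D n j \<omega>)))
             \<le> 3 * (MAX k\<in>{1..n}. norm_L2 M (cond_psum M N X g k)))"
      by (intro exI[of _ ?D]) simp
  qed
qed

end
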